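(* If $G$ is a striped maximal outerplane graph, then $\widetilde{G}$ is a chordal graph.
   Context: Graphs are finite and simple, without isolated vertices. $\widetilde{G}$ is the second power of $G$: the graph with vertex set $V(G)$ and edge set $E(\widetilde{G})=E(G)\cup\{\{i,j\}: i\ne j,\ i,j\in N_G(p)\text{ for some }p\in V(G)\}$, where $N_G(p)$ is the open neighborhood of $p$. An outerplanar graph is a graph that can be drawn in the plane (without crossings) with all its vertices on the boundary of the outer face. It is maximal outerplanar if no edge can be added while keeping it outerplanar. A maximal outerplanar graph embedded in the plane in this way is called a maximal outerplane graph; the boundary of its outer face is its unique Hamiltonian cycle, and its inner faces are triangles. An inner face is a marginal triangle if it is adjacent to (shares an edge with) the outer face, and an internal triangle otherwise. A maximal outerplane graph is called striped if it has no internal triangles. *)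

theory Defs
  imports "HOL-Analysis.Analysis"
begin

section \<open>Finite simple graphs\<close>

definition simple_graph :: "'a set \<Rightarrow> 'a set set \<Rightarrow> bool" where
  "simple_graph V E \<longleftrightarrow> finite V \<and> (\<forall>e\<in>E. e \<subseteq> V \<and> card e = 2)"

definition no_isolated_vertices :: "'a set \<Rightarrow> 'a set set \<Rightarrow> bool" where
  "no_isolated_vertices V E \<longleftrightarrow> (\<forall>v\<in>V. \<exists>e\<in>E. v \<in> e)"

definition open_nbhd :: "'a set set \<Rightarrow> 'a \<Rightarrow> 'a set" where
  "open_nbhd E p = {i. {p, i} \<in> E}"

definition second_power :: "'a set \<Rightarrow> 'a set set \<Rightarrow> 'a set set" where
  "second_power V E =
     E \<union> {{i, j} | i j. i \<noteq> j \<and> (\<exists>p\<in>V. i \<in> open_nbhd E p \<and> j \<in> open_nbhd E p)}"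

definition cycle_edges :: "'a list \<Rightarrow> 'a set set" where
  "cycle_edges vs = {{vs ! i, vs ! (Suc i mod length vs)} | i. i < length vs}"

definition is_cycle :: "'a set \<Rightarrow> 'a set set \<Rightarrow> 'a list \<Rightarrow> bool" where
  "is_cycle V E vs \<longleftrightarrow>
     length vs \<ge> 3 \<and> distinct vs \<and> set vs \<subseteq> V \<and> cycle_edges vs \<subseteq> E"

definition has_chord :: "'a set set \<Rightarrow> 'a list \<Rightarrow> bool" where
  "has_chord E vs \<longleftrightarrow> (\<exists>e\<in>E. e \<subseteq> set vs \<and> e \<notin> cycle_edges vs)"

definition chordal :: "'a set \<Rightarrow> 'a set set \<Rightarrow> bool" where
  "chordal V E \<longleftrightarrow>
     (\<forall>vs. is_cycle V E vs \<and> length vs \<ge> 4 \<longrightarrow> has_chord E vs)"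

section \<open>Plane drawings and their faces\<close>

text \<open>
  The plane is the type of complex numbers. A drawing places each vertex \<open>v\<close> at \<open>pos v\<close>
  and draws each edge \<open>e\<close> as the arc \<open>\<gamma> e\<close>. The orientation of \<open>\<gamma> e\<close> is irrelevant,
  so its two end points are compared with \<open>pos ` e\<close> as sets.
\<close>

definition plane_drawing ::
    "'a set \<Rightarrow> 'a set set \<Rightarrow> ('a \<Rightarrow> complex) \<Rightarrow> ('a set \<Rightarrow> real \<Rightarrow> complex) \<Rightarrow> bool" where
  "plane_drawing V E pos \<gamma> \<longleftrightarrow>
     inj_on pos V \<and>
     (\<forall>e\<in>E. arc (\<gamma> e) \<and> {pathstart (\<gamma> e), pathfinish (\<gamma> e)} = pos ` e \<and>
             path_image (\<gamma> e) \<inter> pos ` V \<subseteq> pos ` e) \<and>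
     (\<forall>e\<in>E. \<forall>f\<in>E. e \<noteq> f \<longrightarrow>
             path_image (\<gamma> e) \<inter> path_image (\<gamma> f) \<subseteq> pos ` (e \<inter> f))"

definition drawn_set ::
    "'a set \<Rightarrow> 'a set set \<Rightarrow> ('a \<Rightarrow> complex) \<Rightarrow> ('a set \<Rightarrow> real \<Rightarrow> complex) \<Rightarrow> complex set" where
  "drawn_set V E pos \<gamma> = pos ` V \<union> (\<Union>e\<in>E. path_image (\<gamma> e))"

text \<open>
  \<open>outside X\<close> is the union of the unbounded components of the complement of \<open>X\<close>; for compact
  \<open>X\<close> in the plane there is exactly one such component.
\<close>

definition outer_face ::
    "'a set \<Rightarrow> 'a set set \<Rightarrow> ('a \<Rightarrow> complex) \<Rightarrow> ('a set \<Rightarrow> real \<Rightarrow> complex) \<Rightarrow> complex set" where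
  "outer_face V E pos \<gamma> = outside (drawn_set V E pos \<gamma>)"

definition inner_faces ::
    "'a set \<Rightarrow> 'a set set \<Rightarrow> ('a \<Rightarrow> complex) \<Rightarrow> ('a set \<Rightarrow> real \<Rightarrow> complex) \<Rightarrow> complex set set" where
  "inner_faces V E pos \<gamma> = {F \<in> components (- drawn_set V E pos \<gamma>). bounded F}"

section \<open>Outerplanar and outerplane graphs\<close>

definition outerplane_drawing ::
    "'a set \<Rightarrow> 'a set set \<Rightarrow> ('a \<Rightarrow> complex) \<Rightarrow> ('a set \<Rightarrow> real \<Rightarrow> complex) \<Rightarrow> bool" where
  "outerplane_drawing V E pos \<gamma> \<longleftrightarrow>
     plane_drawing V E pos \<gamma> \<and> pos ` V \<subseteq> frontier (outer_face V E pos \<gamma>)"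

definition outerplanar :: "'a set \<Rightarrow> 'a set set \<Rightarrow> bool" where
  "outerplanar V E \<longleftrightarrow> (\<exists>pos \<gamma>. outerplane_drawing V E pos \<gamma>)"

definition maximal_outerplanar :: "'a set \<Rightarrow> 'a set set \<Rightarrow> bool" where
  "maximal_outerplanar V E \<longleftrightarrow>
     outerplanar V E \<and>
     (\<forall>u\<in>V. \<forall>v\<in>V. u \<noteq> v \<and> {u, v} \<notin> E \<longrightarrow> \<not> outerplanar V (insert {u, v} E))"

definition maximal_outerplane ::
    "'a set \<Rightarrow> 'a set set \<Rightarrow> ('a \<Rightarrow> complex) \<Rightarrow> ('a set \<Rightarrow> real \<Rightarrow> complex) \<Rightarrow> bool" where
  "maximal_outerplane V E pos \<gamma> \<longleftrightarrow>
     maximal_outerplanar V E \<and> outerplane_drawing V E pos \<gamma>"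

definition marginal_triangle ::
    "'a set \<Rightarrow> 'a set set \<Rightarrow> ('a \<Rightarrow> complex) \<Rightarrow> ('a set \<Rightarrow> real \<Rightarrow> complex) \<Rightarrow> complex set \<Rightarrow> bool"
  where
  "marginal_triangle V E pos \<gamma> F \<longleftrightarrow>
     F \<in> inner_faces V E pos \<gamma> \<and>
     (\<exists>e\<in>E. path_image (\<gamma> e) \<subseteq> frontier F \<and>
             path_image (\<gamma> e) \<subseteq> frontier (outer_face V E pos \<gamma>))"

text \<open>
  In a maximal outerplane graph every inner face is bounded by a triangle, so the next
  definition does not have to say so.
\<close>

definition internal_triangle ::
    "'a set \<Rightarrow> 'a set set \<Rightarrow> ('a \<Rightarrow> complex) \<Rightarrow> ('a set \<Rightarrow> real \<Rightarrow> complex) \<Rightarrow> complex set \<Rightarrow> bool"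
  where
  "internal_triangle V E pos \<gamma> F \<longleftrightarrow>
     F \<in> inner_faces V E pos \<gamma> \<and> \<not> marginal_triangle V E pos \<gamma> F"

definition striped ::
    "'a set \<Rightarrow> 'a set set \<Rightarrow> ('a \<Rightarrow> complex) \<Rightarrow> ('a set \<Rightarrow> real \<Rightarrow> complex) \<Rightarrow> bool" where
  "striped V E pos \<gamma> \<longleftrightarrow> (\<nexists>F. internal_triangle V E pos \<gamma> F)"

end

theory Submission
  imports Defs "HOL-Complex_Analysis.Winding_Numbers"
begin

text \<open>
  A striped maximal outerplane graph is a strip: a triangulated polygon whose triangles follow one
  another in a row, so that every vertex occurs in a run of consecutive triangles. Listing the
  vertices in the order in which the row of triangles meets them gives a linear order in which a
  vertex adjacent to a later vertex is also adjacent to everything in between; such orders are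
  characteristic of interval graphs. In the second power, the neighbours of a vertex \<open>w\<close> that
  precede it all lie in the closed neighbourhood in \<open>G\<close> of a single vertex, namely of the first
  vertex of the closed neighbourhood of \<open>w\<close>. Hence they are pairwise adjacent in the second power,
  and in a cycle of length at least four the two neighbours of the last vertex are joined by a chord
  (\<open>chordal_second_power\<close>).

  The work lies in extracting the strip from a drawing with arbitrary continuous arcs. Three arcs
  with common end points form a theta curve, and one of them runs inside the closed curve formed by
  the other two (\<open>theta_middle_arc\<close>); this is proved by adding up winding numbers. A vertex on the
  boundary of the outer face is never inside a closed curve of the drawing, which excludes two
  configurations: three disjoint paths with inner vertices between the same two vertices
  (\<open>no_theta\<close>), and two crossing chords of a cycle (\<open>no_crossing_chords\<close>). The same tools show that
  each triangle of a striped drawing has an edge that lies in no other triangle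
  (\<open>striped_triangle_outer_edge\<close>). From here on the drawing is forgotten.

  The two excluded configurations suffice to place the vertices on a line such that no two edges
  interleave (\<open>noncrossing_layout\<close>): a longest cycle either passes through all vertices, and then
  gives the layout, or the graph falls apart at a cut vertex. Conversely a graph with such a layout
  has a straight-line outerplane drawing with the vertices on a parabola
  (\<open>noncrossing_outerplanar\<close>). Therefore maximality becomes a statement about layouts: any two
  nonadjacent vertices are separated by an edge. This makes the layout a triangulated polygon; starting
  at an ear and crossing one diagonal after the other, the unshared edge of each triangle leaves only
  one way to go on, and the vertices come out in the desired order (\<open>contiguous_enumeration\<close>).
\<close>

section \<open>Vertex orders with contiguous neighbourhoods\<close>

lemma obtain_max:
  fixes f :: "'a \<Rightarrow> 'b::linorder"
  assumes "finite S" "S \<noteq> {}"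
  obtains m where "m \<in> S" "\<And>v. v \<in> S \<Longrightarrow> f v \<le> f m"
proof -
  have "Max (f ` S) \<in> f ` S" using assms by (intro Max_in) auto
  then obtain m where "m \<in> S" "f m = Max (f ` S)" by auto
  then show thesis using that[of m] assms(1) by simp
qed

lemma obtain_min:
  fixes f :: "'a \<Rightarrow> 'b::linorder"
  assumes "finite S" "S \<noteq> {}"
  obtains m where "m \<in> S" "\<And>v. v \<in> S \<Longrightarrow> f m \<le> f v"
proof -
  have "Min (f ` S) \<in> f ` S" using assms by (intro Min_in) auto
  then obtain m where "m \<in> S" "f m = Min (f ` S)" by auto
  then show thesis using that[of m] assms(1) by simp
qed

text \<open>
  The lower bound is part of the claim only to make room below for the head of the list in the
  induction step.
\<close>

lemma ranking: "distinct xs \<Longrightarrow> \<exists>\<phi> :: 'a \<Rightarrow> real. sorted_wrt (\<lambda>u v. \<phi> u < \<phi> v) xs \<and> (\<forall>v. 0 \<le> \<phi> v)"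
proof (induction xs)
  case (Cons x xs)
  then obtain \<phi> :: "'a \<Rightarrow> real" where \<phi>: "sorted_wrt (\<lambda>u v. \<phi> u < \<phi> v) xs" "\<And>v. 0 \<le> \<phi> v" by auto
  let ?\<psi> = "\<lambda>v. if v = x then 0 else \<phi> v + 1"
  have "sorted_wrt (\<lambda>u v. ?\<psi> u < ?\<psi> v) xs"
    using Cons.prems by (intro sorted_wrt_mono_rel[OF _ \<phi>(1)]) auto
  moreover have "\<forall>v\<in>set xs. ?\<psi> x < ?\<psi> v" using Cons.prems \<phi>(2) by (auto simp: add_nonneg_pos)
  moreover have "\<forall>v. 0 \<le> ?\<psi> v" using \<phi>(2) by simp
  ultimately show ?case by (intro exI[of _ ?\<psi>]) simp
qed (auto intro: exI[of _ "\<lambda>_. 0"])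

lemma sorted_wrt_inj:
  fixes \<phi> :: "'a \<Rightarrow> real"
  assumes "sorted_wrt (\<lambda>u v. \<phi> u < \<phi> v) xs" shows "inj_on \<phi> (set xs)"
  using assms by (induction xs) (fastforce simp: inj_on_def)+

text \<open>
  A finite simple graph has an order with this property if and only if it is an interval graph: order
  the vertices by the left end points of their intervals.
\<close>

definition left_contiguous :: "'a set set \<Rightarrow> 'a set \<Rightarrow> ('a \<Rightarrow> real) \<Rightarrow> bool" where
  "left_contiguous E V \<rho> \<longleftrightarrow> inj_on \<rho> V \<and>
     (\<forall>u\<in>V. \<forall>v\<in>V. \<forall>w\<in>V. \<rho> u < \<rho> v \<and> \<rho> v < \<rho> w \<and> {u, w} \<in> E \<longrightarrow> {u, v} \<in> E)"

text \<open>
  Let \<open>w\<close> be the last vertex of a cycle and \<open>q\<close> the first vertex of the closed neighbourhood of \<open>w\<close>.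
  A vertex \<open>u\<close> between \<open>q\<close> and \<open>w\<close> is adjacent to \<open>q\<close> because \<open>q\<close> is adjacent to \<open>w\<close>. A vertex \<open>u\<close>
  before \<open>q\<close> that reaches \<open>w\<close> through a common neighbour \<open>p\<close> is adjacent to \<open>q\<close> because \<open>q\<close> lies
  between \<open>u\<close> and \<open>p\<close>. So both cycle neighbours of \<open>w\<close> are in the closed neighbourhood of \<open>q\<close> and
  form a chord.
\<close>

lemma chordal_second_power:
  assumes simple: "simple_graph V E" and \<rho>: "left_contiguous E V \<rho>"
  shows "chordal V (second_power V E)"
  unfolding chordal_def
proof (intro allI impI, elim conjE)
  fix vs assume cyc: "is_cycle V (second_power V E) vs" and len: "4 \<le> length vs"
  have dist: "distinct vs" and vsV: "set vs \<subseteq> V" and ce: "cycle_edges vs \<subseteq> second_power V E"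
    using cyc by (auto simp: is_cycle_def)
  have inj: "inj_on \<rho> V" and contig: "\<And>u v w. u \<in> V \<Longrightarrow> v \<in> V \<Longrightarrow> w \<in> V \<Longrightarrow>
      \<rho> u < \<rho> v \<Longrightarrow> \<rho> v < \<rho> w \<Longrightarrow> {u, w} \<in> E \<Longrightarrow> {u, v} \<in> E"
    using \<rho> by (auto simp: left_contiguous_def)
  have EV: "u \<in> V \<and> v \<in> V \<and> u \<noteq> v" if "{u, v} \<in> E" for u v
    using simple that unfolding simple_graph_def by fastforce
  have ne: "vs \<noteq> []" using len by auto
  have "{..<length vs} \<noteq> {}" using ne by auto
  from obtain_max[OF finite_lessThan this, of "\<lambda>i. \<rho> (vs ! i)"]
  obtain i where i: "i < length vs" and imax: "\<And>j. j < length vs \<Longrightarrow> \<rho> (vs ! j) \<le> \<rho> (vs ! i)"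
    by auto
  define w where "w = vs ! i"
  have wV: "w \<in> V" using i vsV by (auto simp: w_def)
  define N where "N = insert w {p. {p, w} \<in> E}"
  have NV: "N \<subseteq> V" using wV EV by (auto simp: N_def)
  have finN: "finite N" using NV simple by (auto simp: simple_graph_def intro: finite_subset)
  have "N \<noteq> {}" by (simp add: N_def)
  then obtain q where q: "q \<in> N" and qmin: "\<And>p. p \<in> N \<Longrightarrow> \<rho> q \<le> \<rho> p"
    using obtain_min[OF finN, of \<rho>] by blast
  have qV: "q \<in> V" using q NV by auto
  have near: "u = q \<or> {u, q} \<in> E"
    if j: "j < length vs" "u = vs ! j" "j \<noteq> i" and uw: "{u, w} \<in> second_power V E" for u j
  proof (cases "u = q")
    case False
    have uV: "u \<in> V" using j vsV by auto
    have "u \<noteq> w" using j i dist by (auto simp: w_def nth_eq_iff_index_eq)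
    then have "\<rho> u \<noteq> \<rho> w" using inj uV wV by (auto simp: inj_on_def)
    then have less: "\<rho> u < \<rho> w" using imax[OF j(1)] j(2) by (simp add: w_def)
    have qu: "\<rho> q \<noteq> \<rho> u" using inj uV qV False by (auto simp: inj_on_def)
    \<comment> \<open>If \<open>u\<close> and \<open>w\<close> are adjacent in the graph itself, \<open>u\<close> serves as its own witness \<open>p\<close>.\<close>
    obtain p where p: "p \<in> N" "u = p \<or> {u, p} \<in> E"
    proof -
      consider "{u, w} \<in> E" | p where "{p, u} \<in> E" "{p, w} \<in> E"
        using uw unfolding second_power_def open_nbhd_def by (auto simp: doubleton_eq_iff)
      then show thesis
        by cases (use that in \<open>auto simp: N_def insert_commute\<close>)
    qed
    have pV: "p \<in> V" using p NV by auto
    show ?thesis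
    proof (cases "\<rho> q < \<rho> u")
      case True
      then have "{q, w} \<in> E" using q less by (auto simp: N_def)
      then have "{q, u} \<in> E" using contig[OF qV uV wV True less] by simp
      then show ?thesis by (simp add: insert_commute)
    next
      case nless: False
      have "u \<noteq> p" using nless qu qmin[OF p(1)] by auto
      then have up: "{u, p} \<in> E" using p by simp
      show ?thesis
      proof (cases "q = p")
        case False
        then have "\<rho> q < \<rho> p" using qmin[OF p(1)] inj qV pV by (auto simp: inj_on_def less_le)
        then show ?thesis using contig[OF uV qV pV _ _ up] nless qu by simp
      qed (use up in simp)
    qed
  qed simp
  \<comment> \<open>The positions after and before that of \<open>w\<close> on the cycle.\<close>
  define j where "j = Suc i mod length vs"
  define k where "k = (if i = 0 then length vs - 1 else i - 1)"
  have j: "j < length vs" "j \<noteq> i" and k: "k < length vs" "k \<noteq> i" and jk: "j \<noteq> k"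
    using i len by (auto simp: j_def k_def mod_Suc)
  have sk: "Suc k mod length vs = i" using i len by (auto simp: k_def)
  have "{vs ! i, vs ! j} \<in> cycle_edges vs" "{vs ! k, vs ! i} \<in> cycle_edges vs"
    using i k sk unfolding cycle_edges_def j_def by auto
  then have "{vs ! j, w} \<in> second_power V E" "{vs ! k, w} \<in> second_power V E"
    using ce by (auto simp: w_def insert_commute)
  then have nj: "vs ! j = q \<or> {vs ! j, q} \<in> E" and nk: "vs ! k = q \<or> {vs ! k, q} \<in> E"
    using near j k by blast+
  have "vs ! j \<noteq> vs ! k" using jk j k dist by (simp add: nth_eq_iff_index_eq)
  then have "{vs ! j, vs ! k} \<in> second_power V E"
  proof (cases "vs ! j = q \<or> vs ! k = q")
    case False
    then have "vs ! j \<in> open_nbhd E q" "vs ! k \<in> open_nbhd E q"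
      using nj nk by (auto simp: open_nbhd_def insert_commute)
    then show ?thesis using qV \<open>vs ! j \<noteq> vs ! k\<close> unfolding second_power_def by blast
  qed (use nj nk \<open>vs ! j \<noteq> vs ! k\<close> in \<open>auto simp: second_power_def insert_commute\<close>)
  moreover have "{vs ! j, vs ! k} \<subseteq> set vs" using j k by simp
  moreover have "{vs ! j, vs ! k} \<notin> cycle_edges vs"
  proof
    assume "{vs ! j, vs ! k} \<in> cycle_edges vs"
    then obtain l where l: "l < length vs" "{vs ! j, vs ! k} = {vs ! l, vs ! (Suc l mod length vs)}"
      by (auto simp: cycle_edges_def)
    have "Suc l mod length vs < length vs" using ne by simp
    then have "j = l \<and> k = Suc l mod length vs \<or> k = l \<and> j = Suc l mod length vs"
      using l j k dist by (auto simp: doubleton_eq_iff nth_eq_iff_index_eq)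
    then show False
      using i len l(1) by (auto simp: j_def k_def mod_Suc split: if_splits)
  qed
  ultimately show "has_chord (second_power V E) vs" unfolding has_chord_def by blast
qed

text \<open>
  The list form of contiguity, suited to building an order by prepending vertices.
\<close>

fun contiguous_list :: "'a set set \<Rightarrow> 'a list \<Rightarrow> bool" where
  "contiguous_list E [] \<longleftrightarrow> True"
| "contiguous_list E (x # xs) \<longleftrightarrow>
     contiguous_list E xs \<and> sorted_wrt (\<lambda>y z. {x, z} \<in> E \<longrightarrow> {x, y} \<in> E) xs"

lemma sorted_wrt_none: "(\<And>z. z \<in> set L \<Longrightarrow> \<not> P z) \<Longrightarrow> sorted_wrt (\<lambda>y z. P z \<longrightarrow> P y) L"
  by (induction L) auto

lemma left_contiguous_of_list:
  fixes \<phi> :: "'a \<Rightarrow> real"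
  assumes "contiguous_list E xs" "sorted_wrt (\<lambda>u v. \<phi> u < \<phi> v) xs"
  shows "left_contiguous E (set xs) \<phi>"
  using assms
proof (induction xs)
  case (Cons x xs)
  have IH: "left_contiguous E (set xs) \<phi>" using Cons by simp
  have less: "\<phi> x < \<phi> v" if "v \<in> set xs" for v using Cons.prems(2) that by simp
  have first: "{x, v} \<in> E" if vw: "v \<in> set xs" "w \<in> set xs" "\<phi> v < \<phi> w" "{x, w} \<in> E" for v w
  proof -
    obtain i j where ij: "i < length xs" "v = xs ! i" "j < length xs" "w = xs ! j"
      using vw(1,2) by (auto simp: in_set_conv_nth)
    have "i < j"
    proof (rule ccontr)
      assume "\<not> i < j"
      then have "i = j \<or> \<phi> w < \<phi> v"
        using sorted_wrt_nth_less[of "\<lambda>u v. \<phi> u < \<phi> v" xs j i] Cons.prems(2) ij by force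
      then show False using vw(3) ij by auto
    qed
    then show ?thesis using Cons.prems(1) ij vw(4) by (auto simp: sorted_wrt_iff_nth_less)
  qed
  show ?case
    unfolding left_contiguous_def
  proof (intro conjI ballI impI)
    show "inj_on \<phi> (set (x # xs))" using Cons.prems(2) by (rule sorted_wrt_inj)
    fix u v w assume V: "u \<in> set (x # xs)" "v \<in> set (x # xs)" "w \<in> set (x # xs)"
      and uvw: "\<phi> u < \<phi> v \<and> \<phi> v < \<phi> w \<and> {u, w} \<in> E"
    have above: "t \<in> set xs" if "s \<in> set (x # xs)" "t \<in> set (x # xs)" "\<phi> s < \<phi> t" for s t
      using that less[of s] by auto
    have vw: "v \<in> set xs" "w \<in> set xs" using above[of u v] above[of v w] V uvw by blast+
    show "{u, v} \<in> E"
    proof (cases "u = x")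
      case True then show ?thesis using first[OF vw] uvw by blast
    next
      case False
      then show ?thesis using IH V(1) vw uvw unfolding left_contiguous_def by auto
    qed
  qed
qed (simp add: left_contiguous_def)

section \<open>Paths and forbidden configurations\<close>

definition gpath :: "'a set set \<Rightarrow> 'a list \<Rightarrow> bool" where
  "gpath E xs \<longleftrightarrow> distinct xs \<and> successively (\<lambda>u v. {u, v} \<in> E) xs"

lemma gpath_append:
  "gpath E (xs @ x # ys) \<longleftrightarrow> gpath E (xs @ [x]) \<and> gpath E (x # ys) \<and> set xs \<inter> set ys = {}"
  by (cases ys) (auto simp: gpath_def successively_append_iff)

lemma gpath_mono: "gpath F xs \<Longrightarrow> F \<subseteq> E \<Longrightarrow> gpath E xs"
  by (auto simp: gpath_def intro: successively_mono)

fun path_edges :: "'a list \<Rightarrow> 'a set set" where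
  "path_edges (x # y # xs) = insert {x, y} (path_edges (y # xs))"
| "path_edges _ = {}"

lemma gpath_rev: "gpath E (rev xs) \<longleftrightarrow> gpath E xs"
  by (simp add: gpath_def insert_commute)

lemma path_edges_append: "path_edges (xs @ x # ys) = path_edges (xs @ [x]) \<union> path_edges (x # ys)"
proof (induction xs)
  case (Cons z xs) then show ?case by (cases xs) auto
qed simp

lemma path_edges_rev: "path_edges (rev xs) = path_edges xs"
proof (induction xs rule: path_edges.induct)
  case (1 x y xs)
  have "path_edges (rev (x # y # xs)) = path_edges (rev xs @ y # [x])" by simp
  also have "\<dots> = path_edges (rev (y # xs)) \<union> {{x, y}}"
    by (subst path_edges_append) (auto simp: insert_commute)
  finally show ?case using 1 by auto
qed auto

lemma gpath_edges: "gpath E xs \<Longrightarrow> path_edges xs \<subseteq> E"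
  by (induction xs rule: path_edges.induct) (auto simp: gpath_def)

lemma path_edges_subset: "e \<in> path_edges xs \<Longrightarrow> e \<subseteq> set xs"
  by (induction xs rule: path_edges.induct) auto

lemma path_edges_finite: "finite (path_edges xs)"
  by (induction xs rule: path_edges.induct) auto

lemma path_edges_ends:
  assumes "distinct (a # X @ [b])" "{a, b} \<in> path_edges (a # X @ [b])"
  shows "X = []"
proof (rule ccontr)
  assume "X \<noteq> []"
  then obtain x X' where X: "X = x # X'" by (cases X) auto
  with assms have "{a, b} = {a, x} \<or> {a, b} \<in> path_edges (x # X' @ [b])" by simp
  then show False
    using assms(1) X path_edges_subset[of "{a, b}" "x # X' @ [b]"] by (auto simp: doubleton_eq_iff)
qed

lemma set_subset_path_edges: "2 \<le> length xs \<Longrightarrow> v \<in> set xs \<Longrightarrow> \<exists>e\<in>path_edges xs. v \<in> e"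
proof (induction xs rule: path_edges.induct)
  case (1 x y xs) then show ?case by (cases xs) auto
qed auto

text \<open>
  A graph satisfying this contains no subdivision of \<open>K\<^sub>2\<^sub>,\<^sub>3\<close>.
\<close>

definition no_theta :: "'a set set \<Rightarrow> bool" where
  "no_theta E \<longleftrightarrow> (\<forall>a b X Y Z. gpath E (a # X @ [b]) \<and> gpath E (a # Y @ [b]) \<and> gpath E (a # Z @ [b]) \<and>
     set X \<inter> set Y = {} \<and> set X \<inter> set Z = {} \<and> set Y \<inter> set Z = {} \<longrightarrow> X = [] \<or> Y = [] \<or> Z = [])"

text \<open>
  The cycle is given by the two paths into which the chord \<open>{a, b}\<close> divides it; the forbidden
  configuration is a subdivision of \<open>K\<^sub>4\<close> with two opposite edges left undivided.
\<close>

definition no_crossing_chords :: "'a set set \<Rightarrow> bool" where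
  "no_crossing_chords E \<longleftrightarrow> (\<forall>a b X Y x y. gpath E (a # X @ [b]) \<and> gpath E (a # Y @ [b]) \<and>
     set X \<inter> set Y = {} \<and> {a, b} \<in> E \<and> x \<in> set X \<and> y \<in> set Y \<longrightarrow> {x, y} \<notin> E)"

lemma no_thetaD:
  assumes "no_theta E" "gpath E (a # X @ [b])" "gpath E (a # Y @ [b])" "gpath E (a # Z @ [b])"
    "set X \<inter> set Y = {}" "set X \<inter> set Z = {}" "set Y \<inter> set Z = {}"
  shows "X = [] \<or> Y = [] \<or> Z = []"
  using assms unfolding no_theta_def by blast

lemma no_crossing_chordsD:
  assumes "no_crossing_chords E" "gpath E (a # X @ [b])" "gpath E (a # Y @ [b])"
    "set X \<inter> set Y = {}" "{a, b} \<in> E" "x \<in> set X" "y \<in> set Y"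
  shows "{x, y} \<notin> E"
  using assms unfolding no_crossing_chords_def by blast

lemma no_theta_mono: "no_theta E \<Longrightarrow> F \<subseteq> E \<Longrightarrow> no_theta F"
  unfolding no_theta_def by (meson gpath_mono)

lemma no_crossing_chords_mono: "no_crossing_chords E \<Longrightarrow> F \<subseteq> E \<Longrightarrow> no_crossing_chords F"
  unfolding no_crossing_chords_def by (meson gpath_mono subsetD)

text \<open>
  For adjacent vertices of a triangulated polygon with more than two vertices, this says that they
  span a side of the polygon rather than a diagonal.
\<close>

definition in_one_triangle :: "'a set set \<Rightarrow> 'a \<Rightarrow> 'a \<Rightarrow> bool" where
  "in_one_triangle E u v \<longleftrightarrow> (\<forall>w w'. {u, w} \<in> E \<and> {v, w} \<in> E \<and> {u, w'} \<in> E \<and> {v, w'} \<in> E \<longrightarrow> w = w')"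

section \<open>Theta curves in the plane\<close>

lemma closed_curve_of_two_arcs:
  fixes c1 c2 :: "real \<Rightarrow> complex"
  assumes "arc c1" "pathstart c1 = a" "pathfinish c1 = b"
    and "arc c2" "pathstart c2 = a" "pathfinish c2 = b"
    and "path_image c1 \<inter> path_image c2 = {a, b}"
  shows "simple_path (c1 +++ reversepath c2)"
    and "pathfinish (c1 +++ reversepath c2) = pathstart (c1 +++ reversepath c2)"
    and "path_image (c1 +++ reversepath c2) = path_image c1 \<union> path_image c2"
  using assms by (auto intro!: simple_path_join_loop simp: arc_reversepath path_image_join)

lemma connected_subset_inside:
  fixes S :: "complex set"
  assumes "connected T" "T \<inter> S = {}" "T \<inter> inside S \<noteq> {}"
  shows "T \<subseteq> inside S"
proof
  fix x assume "x \<in> T"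
  then have "x \<in> inside S \<union> outside S" using assms(2) by (auto simp: inside_Un_outside)
  moreover have "x \<notin> outside S"
    using inside_outside_intersect_connected[OF assms(1), of S] assms(2,3) \<open>x \<in> T\<close> by blast
  ultimately show "x \<in> inside S" by blast
qed

text \<open>
  An inside that meets the inside of the other curve but not that curve itself is contained in it,
  because it is connected. So the two insides are equal, and equal regions have equal boundaries.
\<close>

lemma simple_closed_curves_eqI:
  fixes f g :: "real \<Rightarrow> complex"
  assumes f: "simple_path f" "pathfinish f = pathstart f"
    and g: "simple_path g" "pathfinish g = pathstart g"
    and meet: "inside (path_image f) \<inter> inside (path_image g) \<noteq> {}"
    and fg: "path_image f \<inter> inside (path_image g) = {}"
    and gf: "path_image g \<inter> inside (path_image f) = {}"
  shows "path_image f = path_image g"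
proof -
  note Jf = Jordan_inside_outside[OF f] and Jg = Jordan_inside_outside[OF g]
  have "inside (path_image f) \<subseteq> inside (path_image g)"
    by (rule connected_subset_inside) (use Jf meet gf in auto)
  moreover have "inside (path_image g) \<subseteq> inside (path_image f)"
    by (rule connected_subset_inside) (use Jg meet fg in auto)
  ultimately have "frontier (inside (path_image f)) = frontier (inside (path_image g))"
    by simp
  then show ?thesis using Jf Jg by simp
qed

lemma open_arc_connected_nonempty:
  fixes c :: "real \<Rightarrow> complex"
  assumes "arc c" "pathstart c = a" "pathfinish c = b"
  shows "connected (path_image c - {a, b})" "path_image c - {a, b} \<noteq> {}"
  using assms connected_simple_path_endless[of c] nonempty_simple_path_endless[of c] 
  by (auto simp: arc_imp_simple_path)

text \<open>
  Suppose every arc stays outside the other two, and take a point \<open>z\<close> inside the first two. The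
  winding numbers around \<open>z\<close> of the three closed curves formed by two arcs, suitably oriented, add up
  to \<open>0\<close>, and the first is \<open>1\<close> or \<open>-1\<close>; so \<open>z\<close> is also inside one of the others. Two closed curves
  of the theta then have intersecting insides although neither enters the other, so they coincide,
  which is absurd.
\<close>

lemma theta_middle_arc:
  fixes c1 c2 c3 :: "real \<Rightarrow> complex"
  assumes c1: "arc c1" "pathstart c1 = a" "pathfinish c1 = b"
    and c2: "arc c2" "pathstart c2 = a" "pathfinish c2 = b"
    and c3: "arc c3" "pathstart c3 = a" "pathfinish c3 = b"
    and i12: "path_image c1 \<inter> path_image c2 = {a, b}"
    and i13: "path_image c1 \<inter> path_image c3 = {a, b}"
    and i23: "path_image c2 \<inter> path_image c3 = {a, b}"
  shows "path_image c1 - {a, b} \<subseteq> inside (path_image c2 \<union> path_image c3)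
       \<or> path_image c2 - {a, b} \<subseteq> inside (path_image c1 \<union> path_image c3)
       \<or> path_image c3 - {a, b} \<subseteq> inside (path_image c1 \<union> path_image c2)"
proof (rule ccontr)
  let ?P1 = "path_image c1" and ?P2 = "path_image c2" and ?P3 = "path_image c3"
  note J12 = closed_curve_of_two_arcs[OF c1 c2 i12]
  note J13 = closed_curve_of_two_arcs[OF c1 c3 i13]
  note J23 = closed_curve_of_two_arcs[OF c2 c3 i23]
  have ab: "a \<in> ?P1" "b \<in> ?P1" "a \<in> ?P2" "b \<in> ?P2" "a \<in> ?P3" "b \<in> ?P3"
    using i12 i13 by auto
  assume none: "\<not> ?thesis"
  have off1: "?P1 \<inter> inside (?P2 \<union> ?P3) = {}"
    using none connected_subset_inside[OF open_arc_connected_nonempty(1)[OF c1], of "?P2 \<union> ?P3"]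
      i12 i13 ab inside_no_overlap[of "?P2 \<union> ?P3"] by blast
  have off2: "?P2 \<inter> inside (?P1 \<union> ?P3) = {}"
    using none connected_subset_inside[OF open_arc_connected_nonempty(1)[OF c2], of "?P1 \<union> ?P3"]
      i12 i23 ab inside_no_overlap[of "?P1 \<union> ?P3"] by blast
  have off3: "?P3 \<inter> inside (?P1 \<union> ?P2) = {}"
    using none connected_subset_inside[OF open_arc_connected_nonempty(1)[OF c3], of "?P1 \<union> ?P2"]
      i13 i23 ab inside_no_overlap[of "?P1 \<union> ?P2"] by blast
  have "inside (?P1 \<union> ?P2) \<noteq> {}" using Jordan_inside_outside[OF J12(1,2)] J12(3) by simp
  then obtain z where z: "z \<in> inside (?P1 \<union> ?P2)" by blast
  have z1: "z \<notin> ?P1" and z2: "z \<notin> ?P2" and z3: "z \<notin> ?P3"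
    using z off3 inside_no_overlap[of "?P1 \<union> ?P2"] by blast+
  have p: "path c1" "path c2" "path c3" using c1 c2 c3 by (auto simp: arc_imp_path)
  have w12: "winding_number (c1 +++ reversepath c2) z = winding_number c1 z - winding_number c2 z"
    using z1 z2 p c1 c2 by (simp add: winding_number_join winding_number_reversepath)
  have w13: "winding_number (c1 +++ reversepath c3) z = winding_number c1 z - winding_number c3 z"
    using z1 z3 p c1 c3 by (simp add: winding_number_join winding_number_reversepath)
  have w23: "winding_number (c2 +++ reversepath c3) z = winding_number c2 z - winding_number c3 z"
    using z2 z3 p c2 c3 by (simp add: winding_number_join winding_number_reversepath)
  have n12: "norm (winding_number (c1 +++ reversepath c2) z) = 1"
    using simple_closed_path_norm_winding_number_inside[OF J12(1)] z J12(3) by simp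
  have n13: "winding_number (c1 +++ reversepath c3) z = 0" if "z \<in> outside (?P1 \<union> ?P3)"
    using winding_number_zero_in_outside[of "c1 +++ reversepath c3" z] J13 that
    by (simp add: simple_path_imp_path)
  have n23: "winding_number (c2 +++ reversepath c3) z = 0" if "z \<in> outside (?P2 \<union> ?P3)"
    using winding_number_zero_in_outside[of "c2 +++ reversepath c3" z] J23 that
    by (simp add: simple_path_imp_path)
  have "\<not> (z \<in> outside (?P1 \<union> ?P3) \<and> z \<in> outside (?P2 \<union> ?P3))"
    using n12 n13 n23 w12 w13 w23 by auto
  then have "z \<in> inside (?P1 \<union> ?P3) \<or> z \<in> inside (?P2 \<union> ?P3)"
    using z1 z2 z3 inside_Un_outside[of "?P1 \<union> ?P3"] inside_Un_outside[of "?P2 \<union> ?P3"]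
    by blast
  then have "?P1 \<union> ?P2 = ?P1 \<union> ?P3 \<or> ?P1 \<union> ?P2 = ?P2 \<union> ?P3"
  proof
    assume "z \<in> inside (?P1 \<union> ?P3)"
    then have "?P1 \<union> ?P2 = ?P1 \<union> ?P3"
      using simple_closed_curves_eqI[OF J12(1,2) J13(1,2), unfolded J12(3) J13(3)] z off2 off3
        inside_no_overlap[of "?P1 \<union> ?P3"] inside_no_overlap[of "?P1 \<union> ?P2"] by blast
    then show ?thesis ..
  next
    assume "z \<in> inside (?P2 \<union> ?P3)"
    then have "?P1 \<union> ?P2 = ?P2 \<union> ?P3"
      using simple_closed_curves_eqI[OF J12(1,2) J23(1,2), unfolded J12(3) J23(3)] z off1 off3
        inside_no_overlap[of "?P2 \<union> ?P3"] inside_no_overlap[of "?P1 \<union> ?P2"] by blast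
    then show ?thesis ..
  qed
  then show False
    using open_arc_connected_nonempty(2)[OF c1] open_arc_connected_nonempty(2)[OF c2] i12 i13 i23
    by blast
qed

lemma arc_minus_end_connected:
  fixes c :: "real \<Rightarrow> complex"
  assumes "arc c" "p = pathstart c \<or> p = pathfinish c"
  shows "connected (path_image c - {p})"
proof -
  have *: "connected (path_image g - {pathstart g})" if "arc g" for g :: "real \<Rightarrow> complex"
  proof -
    have "path_image g - {pathstart g} = g ` ({0..1} - {0})"
      using that by (auto simp: arc_def path_image_def pathstart_def inj_on_def)
    also have "{0..1} - {0} = {0<..1::real}" by auto
    finally show ?thesis
      using that by (metis arc_imp_path connected_Ioc connected_continuous_image continuous_on_subset
          greaterThanAtMost_subseteq_atLeastAtMost_iff order_refl path_def)
  qed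
  from assms(2) show ?thesis
    using *[OF assms(1)] *[of "reversepath c"] assms(1) by (auto simp: arc_reversepath)
qed

section \<open>Outerplane drawings\<close>

locale outerplane_graph =
  fixes V :: "'a set" and E :: "'a set set"
    and pos :: "'a \<Rightarrow> complex" and \<gamma> :: "'a set \<Rightarrow> real \<Rightarrow> complex"
  assumes simple: "simple_graph V E"
    and drawing: "outerplane_drawing V E pos \<gamma>"
begin

abbreviation "D \<equiv> drawn_set V E pos \<gamma>"

definition curve :: "'a list \<Rightarrow> complex set" where
  "curve xs = (\<Union>e\<in>path_edges xs. path_image (\<gamma> e))"

lemma edgeD: "e \<in> E \<Longrightarrow> e \<subseteq> V" "e \<in> E \<Longrightarrow> card e = 2"
  using simple by (auto simp: simple_graph_def)

lemma edge_ends: "{u, v} \<in> E \<Longrightarrow> u \<noteq> v" "{u, v} \<in> E \<Longrightarrow> u \<in> V" "{u, v} \<in> E \<Longrightarrow> v \<in> V"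
  using edgeD[of "{u, v}"] by auto

lemma
  shows inj_pos: "inj_on pos V"
    and arc_edge: "e \<in> E \<Longrightarrow> arc (\<gamma> e)"
    and ends_edge: "e \<in> E \<Longrightarrow> {pathstart (\<gamma> e), pathfinish (\<gamma> e)} = pos ` e"
    and vertex_on_edge: "e \<in> E \<Longrightarrow> path_image (\<gamma> e) \<inter> pos ` V \<subseteq> pos ` e"
    and edges_meet: "e \<in> E \<Longrightarrow> f \<in> E \<Longrightarrow> e \<noteq> f \<Longrightarrow> path_image (\<gamma> e) \<inter> path_image (\<gamma> f) \<subseteq> pos ` (e \<inter> f)"
    and vertex_outer: "v \<in> V \<Longrightarrow> pos v \<in> frontier (outer_face V E pos \<gamma>)"
  using drawing by (auto simp: outerplane_drawing_def plane_drawing_def)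

lemma pos_eq_iff: "u \<in> V \<Longrightarrow> v \<in> V \<Longrightarrow> pos u = pos v \<longleftrightarrow> u = v"
  using inj_pos by (auto simp: inj_on_def)

lemma pos_in_edge: "e \<in> E \<Longrightarrow> v \<in> V \<Longrightarrow> pos v \<in> path_image (\<gamma> e) \<longleftrightarrow> v \<in> e"
proof
  assume "e \<in> E" "v \<in> V" "pos v \<in> path_image (\<gamma> e)"
  then show "v \<in> e" using vertex_on_edge[of e] edgeD(1)[of e] pos_eq_iff by blast
next
  assume "e \<in> E" "v \<in> V" "v \<in> e"
  then have "pos v \<in> {pathstart (\<gamma> e), pathfinish (\<gamma> e)}" using ends_edge by blast
  then show "pos v \<in> path_image (\<gamma> e)" by auto
qed

lemma compact_edge: "e \<in> E \<Longrightarrow> compact (path_image (\<gamma> e))"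
  using arc_edge by (simp add: compact_arc_image)

lemma closed_edges: "S \<subseteq> E \<Longrightarrow> finite S \<Longrightarrow> closed (\<Union>e\<in>S. path_image (\<gamma> e))"
  using compact_edge by (auto intro: compact_imp_closed)

lemma edge_connected_minus: "e \<in> E \<Longrightarrow> v \<in> e \<Longrightarrow> connected (path_image (\<gamma> e) - {pos v})"
  by (rule arc_minus_end_connected) (use arc_edge ends_edge in blast)+

text \<open>
  The inside of a part of the drawing is open and disjoint from the outer face, hence misses the
  closure of that face. All topological contradictions below end here.
\<close>

lemma outer_frontier_not_inside:
  assumes "z \<in> frontier (outer_face V E pos \<gamma>)" "closed S" "S \<subseteq> D"
  shows "z \<notin> inside S"
proof
  assume "z \<in> inside S"
  moreover have "open (inside S)" using assms(2) by (rule open_inside)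
  moreover have "z \<in> closure (outside D)"
    using assms(1) by (auto simp: frontier_def outer_face_def)
  ultimately have "inside S \<inter> outside D \<noteq> {}"
    by (metis IntI closure_iff_nhds_not_empty emptyE open_Int_closure_eq_empty)
  then show False using outside_mono[OF assms(3)] inside_Int_outside[of S] by blast
qed

lemma curve_closed: "gpath E xs \<Longrightarrow> closed (curve xs)"
  unfolding curve_def by (intro closed_edges gpath_edges path_edges_finite)

lemma curve_drawn: "gpath E xs \<Longrightarrow> curve xs \<subseteq> D"
  using gpath_edges by (fastforce simp: curve_def drawn_set_def)

lemma gpath_in_V: "gpath E xs \<Longrightarrow> 2 \<le> length xs \<Longrightarrow> set xs \<subseteq> V"
  using set_subset_path_edges gpath_edges edgeD(1) by fast

lemma pos_in_curve:
  assumes "gpath E xs" "2 \<le> length xs" "v \<in> V"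
  shows "pos v \<in> curve xs \<longleftrightarrow> v \<in> set xs"
proof
  assume "pos v \<in> curve xs"
  then show "v \<in> set xs"
    using pos_in_edge[OF _ assms(3)] gpath_edges[OF assms(1)] path_edges_subset
    unfolding curve_def by fast
next
  assume "v \<in> set xs"
  then show "pos v \<in> curve xs"
    using set_subset_path_edges[OF assms(2)] pos_in_edge[OF _ assms(3)] gpath_edges[OF assms(1)]
    unfolding curve_def by fast
qed

lemma edge_arc:
  assumes "{u, v} \<in> E"
  obtains c where "arc c" "pathstart c = pos u" "pathfinish c = pos v"
    "path_image c = path_image (\<gamma> {u, v})"
proof -
  have "{pathstart (\<gamma> {u, v}), pathfinish (\<gamma> {u, v})} = {pos u, pos v}"
    using ends_edge[OF assms] by simp
  then consider "pathstart (\<gamma> {u, v}) = pos u" "pathfinish (\<gamma> {u, v}) = pos v"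
    | "pathstart (\<gamma> {u, v}) = pos v" "pathfinish (\<gamma> {u, v}) = pos u"
    by (auto simp: doubleton_eq_iff)
  then show thesis
  proof cases
    case 1 then show ?thesis using that arc_edge[OF assms] by blast
  next
    case 2 then show ?thesis
      using that[of "reversepath (\<gamma> {u, v})"] arc_edge[OF assms] by (simp add: arc_reversepath)
  qed
qed

lemma path_arc:
  assumes "gpath E xs" "2 \<le> length xs"
  obtains c where "arc c" "pathstart c = pos (hd xs)" "pathfinish c = pos (last xs)"
    "path_image c = curve xs"
  using assms
proof (induction xs arbitrary: thesis rule: path_edges.induct)
  case (1 x y xs)
  have xy: "{x, y} \<in> E" and g: "gpath E (y # xs)" and x: "x \<notin> set (y # xs)"
    using "1.prems"(2) by (auto simp: gpath_def)
  obtain c where c: "arc c" "pathstart c = pos x" "pathfinish c = pos y"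
    "path_image c = path_image (\<gamma> {x, y})" using edge_arc[OF xy] .
  show ?case
  proof (cases "xs = []")
    case True then show ?thesis using c "1.prems"(1)[of c] by (simp add: curve_def)
  next
    case False
    then have "2 \<le> length (y # xs)" by (cases xs) auto
    then obtain d where d: "arc d" "pathstart d = pos y" "pathfinish d = pos (last (y # xs))"
      "path_image d = curve (y # xs)" using "1.IH"[OF _ g] by auto
    have meet: "path_image c \<inter> path_image d \<subseteq> {pos y}"
    proof
      fix z assume "z \<in> path_image c \<inter> path_image d"
      then obtain f where f: "f \<in> path_edges (y # xs)" "z \<in> path_image (\<gamma> {x, y}) \<inter> path_image (\<gamma> f)"
        using c d by (auto simp: curve_def)
      have "f \<subseteq> set (y # xs)" "f \<in> E" using path_edges_subset[OF f(1)] gpath_edges[OF g] f(1) by auto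
      then show "z \<in> {pos y}" using edges_meet[OF xy, of f] f(2) x by auto
    qed
    have "arc (c +++ d)" using c d meet by (intro arc_join) auto
    moreover have "path_image (c +++ d) = curve (x # y # xs)"
      using c d by (auto simp: path_image_join curve_def)
    ultimately show ?thesis using "1.prems"(1)[of "c +++ d"] c d False by simp
  qed
qed auto

text \<open>
  Edges of two different paths meet only in common end vertices. Both paths could share the edge
  \<open>{a, b}\<close> only if both consisted of it alone.
\<close>

lemma curves_meet:
  assumes "gpath E (a # X @ [b])" "gpath E (a # Y @ [b])" "set X \<inter> set Y = {}" "X \<noteq> [] \<or> Y \<noteq> []"
  shows "curve (a # X @ [b]) \<inter> curve (a # Y @ [b]) = {pos a, pos b}"
proof
  show "curve (a # X @ [b]) \<inter> curve (a # Y @ [b]) \<subseteq> {pos a, pos b}"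
  proof
    fix z assume "z \<in> curve (a # X @ [b]) \<inter> curve (a # Y @ [b])"
    then obtain e f where e: "e \<in> path_edges (a # X @ [b])" and f: "f \<in> path_edges (a # Y @ [b])"
      and z: "z \<in> path_image (\<gamma> e)" "z \<in> path_image (\<gamma> f)" unfolding curve_def by blast
    have E: "e \<in> E" "f \<in> E" using gpath_edges e f assms by blast+
    have sub: "e \<inter> f \<subseteq> {a, b}"
      using path_edges_subset[OF e] path_edges_subset[OF f] assms(3) by auto
    have "e \<noteq> f"
    proof
      assume "e = f"
      have "a \<noteq> b" using assms(1) by (simp add: gpath_def)
      then have "e = {a, b}" using sub \<open>e = f\<close> edgeD(2)[OF E(1)] by (intro card_seteq) auto
      then show False
        using path_edges_ends[of a X b] path_edges_ends[of a Y b] e f \<open>e = f\<close> assms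
        by (auto simp: gpath_def)
    qed
    then show "z \<in> {pos a, pos b}" using edges_meet[OF E] z sub by blast
  qed
next
  have "a \<in> V" "b \<in> V" using gpath_in_V[OF assms(1)] by auto
  then show "{pos a, pos b} \<subseteq> curve (a # X @ [b]) \<inter> curve (a # Y @ [b])"
    using pos_in_curve[OF assms(1)] pos_in_curve[OF assms(2)] by simp
qed

lemma vertex_not_inside_curves:
  assumes "v \<in> V" "gpath E P" "gpath E Q"
  shows "pos v \<notin> inside (curve P \<union> curve Q)"
  using assms curve_closed curve_drawn
  by (intro outer_frontier_not_inside vertex_outer closed_Un Un_least) auto

lemma path_with_interior_not_inside:
  assumes L: "gpath E (a # L @ [b])" "L \<noteq> []" and PQ: "gpath E P" "gpath E Q"
  shows "\<not> curve (a # L @ [b]) - {pos a, pos b} \<subseteq> inside (curve P \<union> curve Q)"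
proof -
  have V: "set (a # L @ [b]) \<subseteq> V" using gpath_in_V[OF L(1)] by simp
  have *: "hd L \<in> set L" using L(2) by simp
  then have "hd L \<noteq> a" "hd L \<noteq> b" using L(1) by (auto simp: gpath_def)
  then have "pos (hd L) \<in> curve (a # L @ [b]) - {pos a, pos b}"
    using V * pos_in_curve[OF L(1)] pos_eq_iff by auto
  moreover have "hd L \<in> V" using V * by auto
  ultimately show ?thesis using vertex_not_inside_curves[OF _ PQ] by blast
qed

text \<open>
  One of the three paths runs inside the other two. A path with an inner vertex cannot, because that
  vertex is on the boundary of the outer face; this leaves only the third path.
\<close>

lemma theta_inside:
  assumes X: "gpath E (a # X @ [b])" and Y: "gpath E (a # Y @ [b])" and Z: "gpath E (a # Z @ [b])"
    and disj: "set X \<inter> set Y = {}" "set X \<inter> set Z = {}" "set Y \<inter> set Z = {}"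
    and ne: "X \<noteq> []" "Y \<noteq> []"
  shows "curve (a # Z @ [b]) - {pos a, pos b} \<subseteq> inside (curve (a # X @ [b]) \<union> curve (a # Y @ [b]))"
proof -
  obtain c1 where c1: "arc c1" "pathstart c1 = pos a" "pathfinish c1 = pos b"
    "path_image c1 = curve (a # X @ [b])" using path_arc[OF X] by auto
  obtain c2 where c2: "arc c2" "pathstart c2 = pos a" "pathfinish c2 = pos b"
    "path_image c2 = curve (a # Y @ [b])" using path_arc[OF Y] by auto
  obtain c3 where c3: "arc c3" "pathstart c3 = pos a" "pathfinish c3 = pos b"
    "path_image c3 = curve (a # Z @ [b])" using path_arc[OF Z] by auto
  show ?thesis
    using theta_middle_arc[OF c1(1-3) c2(1-3) c3(1-3)] c1(4) c2(4) c3(4)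
      curves_meet[OF X Y disj(1)] curves_meet[OF X Z disj(2)] curves_meet[OF Y Z disj(3)] ne
      path_with_interior_not_inside[OF X ne(1) Y Z] path_with_interior_not_inside[OF Y ne(2) X Z] by auto
qed

lemma no_theta: "no_theta E"
  unfolding no_theta_def
proof (intro allI impI, elim conjE)
  fix a b X Y Z
  assume g: "gpath E (a # X @ [b])" "gpath E (a # Y @ [b])" "gpath E (a # Z @ [b])"
    and disj: "set X \<inter> set Y = {}" "set X \<inter> set Z = {}" "set Y \<inter> set Z = {}"
  show "X = [] \<or> Y = [] \<or> Z = []"
  proof (rule ccontr)
    assume "\<not> ?thesis"
    then show False
      using theta_inside[OF g disj] path_with_interior_not_inside[OF g(3) _ g(1,2)] by blast
  qed
qed

lemma chord_inside:
  assumes X: "gpath E (a # X @ [b])" and Y: "gpath E (a # Y @ [b])" and disj: "set X \<inter> set Y = {}"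
    and ne: "X \<noteq> []" "Y \<noteq> []" and e: "{a, b} \<in> E"
  shows "path_image (\<gamma> {a, b}) - {pos a, pos b} \<subseteq> inside (curve (a # X @ [b]) \<union> curve (a # Y @ [b]))"
proof -
  have "gpath E (a # [] @ [b])" using e edge_ends[OF e] by (simp add: gpath_def)
  from theta_inside[OF X Y this disj _ _ ne] show ?thesis by (simp add: curve_def)
qed

text \<open>
  Both chords run inside the cycle. The chord \<open>{a, b}\<close> splits this region in two, and \<open>{x, y}\<close>, which
  avoids it, stays in one of the parts. But \<open>x\<close> and \<open>y\<close> lie on different arcs of the cycle, so one of
  them is not on the boundary of that part and would have to be inside it.
\<close>

lemma no_crossing_chords: "no_crossing_chords E"
  unfolding no_crossing_chords_def
proof (intro allI impI notI, elim conjE)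
  fix a b X Y x y
  assume X: "gpath E (a # X @ [b])" and Y: "gpath E (a # Y @ [b])"
    and disj: "set X \<inter> set Y = {}" and e: "{a, b} \<in> E"
    and x: "x \<in> set X" and y: "y \<in> set Y" and f: "{x, y} \<in> E"
  let ?C = "curve (a # X @ [b]) \<union> curve (a # Y @ [b])"
  let ?e = "path_image (\<gamma> {a, b})" and ?f = "path_image (\<gamma> {x, y})"
  have ne: "X \<noteq> []" "Y \<noteq> []" using x y by auto
  have xV: "x \<in> V" and yV: "y \<in> V" using edge_ends[OF f] by simp_all
  have ab: "gpath E (a # [] @ [b])" using e edge_ends[OF e] by (simp add: gpath_def)
  have cab: "curve (a # [] @ [b]) = ?e" by (simp add: curve_def)
  have xy: "x \<noteq> a" "x \<noteq> b" "y \<noteq> a" "y \<noteq> b" "x \<noteq> y"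
    using x y X Y disj by (auto simp: gpath_def)
  obtain X1 X2 where X12: "X = X1 @ x # X2" using split_list[OF x] by blast
  obtain Y1 Y2 where Y12: "Y = Y1 @ y # Y2" using split_list[OF y] by blast
  let ?P = "rev X1 @ a # Y1" and ?Q = "X2 @ b # rev Y2"
  have gX: "gpath E (a # X1 @ [x])" "gpath E (x # X2 @ [b])" "set (a # X1) \<inter> set (X2 @ [b]) = {}"
    using X gpath_append[of E "a # X1" x "X2 @ [b]"] by (simp_all add: X12)
  have gY: "gpath E (a # Y1 @ [y])" "gpath E (y # Y2 @ [b])" "set (a # Y1) \<inter> set (Y2 @ [b]) = {}"
    using Y gpath_append[of E "a # Y1" y "Y2 @ [b]"] by (simp_all add: Y12)
  have dXY: "set X1 \<inter> set Y1 = {}" "set X2 \<inter> set Y2 = {}" "set X1 \<inter> set Y2 = {}" "set X2 \<inter> set Y1 = {}"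
    "y \<notin> set X1" "y \<notin> set X2" "x \<notin> set Y1" "x \<notin> set Y2" using disj by (auto simp: X12 Y12)
  have gP: "gpath E (x # ?P @ [y])"
    using gpath_append[of E "x # rev X1" a "Y1 @ [y]"] gpath_rev[of E "a # X1 @ [x]"] gX gY dXY xy
    by simp
  have gQ: "gpath E (x # ?Q @ [y])"
    using gpath_append[of E "x # X2" b "rev Y2 @ [y]"] gpath_rev[of E "y # Y2 @ [b]"] gX gY dXY xy
    by simp
  have dPQ: "set ?P \<inter> set ?Q = {}" using gX(3) gY(3) dXY by auto
  have pP: "path_edges (x # ?P @ [y]) = path_edges (a # X1 @ [x]) \<union> path_edges (a # Y1 @ [y])"
    using path_edges_append[of "x # rev X1" a "Y1 @ [y]"] path_edges_rev[of "a # X1 @ [x]"] by simp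
  have pQ: "path_edges (x # ?Q @ [y]) = path_edges (x # X2 @ [b]) \<union> path_edges (y # Y2 @ [b])"
    using path_edges_append[of "x # X2" b "rev Y2 @ [y]"] path_edges_rev[of "y # Y2 @ [b]"] by simp
  have pX: "path_edges (a # X @ [b]) = path_edges (a # X1 @ [x]) \<union> path_edges (x # X2 @ [b])"
    using path_edges_append[of "a # X1" x "X2 @ [b]"] by (simp add: X12)
  have pY: "path_edges (a # Y @ [b]) = path_edges (a # Y1 @ [y]) \<union> path_edges (y # Y2 @ [b])"
    using path_edges_append[of "a # Y1" y "Y2 @ [b]"] by (simp add: Y12)
  \<comment> \<open>\<open>x\<close> and \<open>y\<close> divide the same cycle into the paths through \<open>a\<close> and through \<open>b\<close>.\<close>
  have C: "curve (x # ?P @ [y]) \<union> curve (x # ?Q @ [y]) = ?C"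
    unfolding curve_def pP pQ pX pY by blast
  have e_in: "?e - {pos a, pos b} \<subseteq> inside ?C"
    by (rule chord_inside[OF X Y disj ne e])
  have f_in: "?f - {pos x, pos y} \<subseteq> inside ?C"
    unfolding C[symmetric] by (rule chord_inside[OF gP gQ dPQ _ _ f]) simp_all
  obtain c1 where c1: "arc c1" "pathstart c1 = pos a" "pathfinish c1 = pos b"
    "path_image c1 = curve (a # X @ [b])" using path_arc[OF X] by auto
  obtain c2 where c2: "arc c2" "pathstart c2 = pos a" "pathfinish c2 = pos b"
    "path_image c2 = curve (a # Y @ [b])" using path_arc[OF Y] by auto
  obtain c where c: "arc c" "pathstart c = pos a" "pathfinish c = pos b"
    "path_image c = ?e" using edge_arc[OF e] .
  have "pos a \<noteq> pos b" using edge_ends[OF e] pos_eq_iff by simp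
  moreover have "?e \<inter> inside ?C \<noteq> {}"
    using e_in open_arc_connected_nonempty(2)[OF c(1-3)] c(4) by blast
  moreover have "curve (a # X @ [b]) \<inter> ?e = {pos a, pos b}" "curve (a # Y @ [b]) \<inter> ?e = {pos a, pos b}"
    using curves_meet[OF X ab] curves_meet[OF Y ab] ne cab by auto
  ultimately have split: "inside ?C = inside (curve (a # X @ [b]) \<union> ?e) \<union> inside (curve (a # Y @ [b]) \<union> ?e)
      \<union> (?e - {pos a, pos b})"
    using split_inside_simple_closed_curve[of c1 "pos a" "pos b" c2 c, OF arc_imp_simple_path[OF c1(1)] c1(2,3)
        arc_imp_simple_path[OF c2(1)] c2(2,3) arc_imp_simple_path[OF c(1)] c(2,3)]
      curves_meet[OF X Y disj] ne unfolding c1(4) c2(4) c(4) by metis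
  have fe: "?f \<inter> ?e = {}" using edges_meet[OF f e] xy by auto
  have not_in: "pos v \<notin> inside (curve (a # L @ [b]) \<union> ?e)"
    if "v \<in> V" "gpath E (a # L @ [b])" for v L
    using vertex_not_inside_curves[OF that ab] cab by simp
  have off: "inside ?C \<inter> ?C = {}" using inside_no_overlap[of ?C] by blast
  have pxy: "pos x \<in> ?f" "pos y \<in> ?f" using pos_in_edge[OF f] xV yV by simp_all
  have pnot: "pos y \<notin> curve (a # X @ [b])" "pos x \<notin> curve (a # Y @ [b])"
    using pos_in_curve[OF X _ yV] pos_in_curve[OF Y _ xV] x y xy disj by auto
  have "?f - {pos x, pos y} \<noteq> {}"
    using edge_arc[OF f] open_arc_connected_nonempty(2) by metis
  then obtain z where z: "z \<in> ?f" "z \<noteq> pos x" "z \<noteq> pos y" by blast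
  have zC: "z \<in> inside ?C" "z \<notin> ?e" using z f_in fe by blast+
  have "z \<in> inside (curve (a # X @ [b]) \<union> ?e) \<union> inside (curve (a # Y @ [b]) \<union> ?e)
      \<union> (?e - {pos a, pos b})" using zC(1) by (simp only: split)
  then consider "z \<in> inside (curve (a # X @ [b]) \<union> ?e)" | "z \<in> inside (curve (a # Y @ [b]) \<union> ?e)"
    using zC(2) by fast
  then show False
  proof cases
    case 1
    \<comment> \<open>Keeping the end \<open>pos y\<close> of the arc carries \<open>pos y\<close> itself into the inside.\<close>
    have "?f - {pos x} \<subseteq> inside (curve (a # X @ [b]) \<union> ?e)"
    proof (rule connected_subset_inside)
      show "connected (?f - {pos x})" by (rule edge_connected_minus[OF f]) simp
      have "?f - {pos x} \<subseteq> inside ?C \<union> {pos y}" using f_in by blast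
      then show "(?f - {pos x}) \<inter> (curve (a # X @ [b]) \<union> ?e) = {}" using off fe pnot(1) by blast
      show "(?f - {pos x}) \<inter> inside (curve (a # X @ [b]) \<union> ?e) \<noteq> {}" using 1 z by blast
    qed
    moreover have "pos y \<noteq> pos x" using xy(5) xV yV pos_eq_iff by metis
    ultimately show False using not_in[OF yV X] pxy by blast
  next
    case 2
    have "?f - {pos y} \<subseteq> inside (curve (a # Y @ [b]) \<union> ?e)"
    proof (rule connected_subset_inside)
      show "connected (?f - {pos y})" by (rule edge_connected_minus[OF f]) simp
      have "?f - {pos y} \<subseteq> inside ?C \<union> {pos x}" using f_in by blast
      then show "(?f - {pos y}) \<inter> (curve (a # Y @ [b]) \<union> ?e) = {}" using off fe pnot(2) by blast
      show "(?f - {pos y}) \<inter> inside (curve (a # Y @ [b]) \<union> ?e) \<noteq> {}" using 2 z by blast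
    qed
    moreover have "pos x \<noteq> pos y" using xy(5) xV yV pos_eq_iff by metis
    ultimately show False using not_in[OF xV Y] pxy by blast
  qed
qed

text \<open>
  The closed curve drawn for the triangle has an empty inside: it contains no vertex, and an edge
  entering it would have an end vertex there. So its inside is an inner face, and by stripedness one
  of the three edges is also on the boundary of the outer face. If that edge were in a second triangle,
  it would run inside the cycle formed by the other edges of the two triangles, away from the outer
  face.
\<close>

lemma striped_triangle_outer_edge:
  assumes striped: "striped V E pos \<gamma>"
    and tri: "{x, y} \<in> E" "{y, z} \<in> E" "{x, z} \<in> E"
  shows "in_one_triangle E x y \<or> in_one_triangle E y z \<or> in_one_triangle E x z"
proof -
  let ?T = "{{x, y}, {y, z}, {x, z}}"
  let ?J = "\<Union>e\<in>?T. path_image (\<gamma> e)"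
  have d: "x \<noteq> y" "y \<noteq> z" "x \<noteq> z" using tri edge_ends by auto
  have V: "x \<in> V" "y \<in> V" "z \<in> V" using tri edge_ends by auto
  have TE: "?T \<subseteq> E" using tri by simp
  have g1: "gpath E (x # [y] @ [z])" and g2: "gpath E (x # [] @ [z])"
    using tri d by (auto simp: gpath_def)
  obtain c1 where c1: "arc c1" "pathstart c1 = pos x" "pathfinish c1 = pos z"
    "path_image c1 = curve (x # [y] @ [z])" using path_arc[OF g1] by auto
  obtain c2 where c2: "arc c2" "pathstart c2 = pos x" "pathfinish c2 = pos z"
    "path_image c2 = curve (x # [] @ [z])" using path_arc[OF g2] by auto
  have "path_image c1 \<inter> path_image c2 = {pos x, pos z}" using curves_meet[OF g1 g2] c1 c2 by simp
  note J = closed_curve_of_two_arcs[OF c1(1-3) c2(1-3) this]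
  have J_eq: "path_image c1 \<union> path_image c2 = ?J" using c1 c2 by (auto simp: curve_def)
  note JJ = Jordan_inside_outside[OF J(1,2), unfolded J(3) J_eq]
  have JD: "?J \<subseteq> D" using TE by (auto simp: drawn_set_def)
  have Jcl: "closed ?J" by (rule closed_edges) (use TE in auto)
  have vJ: "pos v \<notin> inside ?J" if "v \<in> V" for v
    using outer_frontier_not_inside[OF vertex_outer[OF that] Jcl JD] .
  \<comment> \<open>An edge other than the three sides has an end \<open>t\<close> outside \<open>{x, y, z}\<close>; without its other end it avoids the curve, so entering the inside would carry \<open>t\<close> there.\<close>
  have fJ: "path_image (\<gamma> f) \<inter> inside ?J = {}" if f: "f \<in> E" for f
  proof (rule ccontr)
    assume "path_image (\<gamma> f) \<inter> inside ?J \<noteq> {}"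
    then obtain q where q: "q \<in> path_image (\<gamma> f)" "q \<in> inside ?J" by blast
    then have fT: "f \<notin> ?T" using inside_no_overlap[of ?J] by blast
    obtain u v where uv: "f = {u, v}" "u \<noteq> v" using edgeD(2)[OF f] by (auto simp: card_2_iff)
    have uvV: "u \<in> V" "v \<in> V" using edge_ends f uv by auto
    have "\<not> (u \<in> {x, y, z} \<and> v \<in> {x, y, z})" using fT uv by (auto simp: insert_commute)
    then obtain s t where st: "f = {s, t}" "s \<noteq> t" "t \<notin> {x, y, z}" "s \<in> V" "t \<in> V"
      using uv uvV by (metis insert_commute)
    have "path_image (\<gamma> f) - {pos s} \<subseteq> inside ?J"
    proof (rule connected_subset_inside)
      show "connected (path_image (\<gamma> f) - {pos s})" using edge_connected_minus[OF f] st by simp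
      have "path_image (\<gamma> f) \<inter> path_image (\<gamma> e) \<subseteq> {pos s}" if "e \<in> ?T" for e
      proof -
        have "f \<inter> e \<subseteq> {s}" using that st by auto
        moreover have "e \<in> E" "f \<noteq> e" using that fT TE by auto
        ultimately show ?thesis using edges_meet[OF f, of e] by blast
      qed
      then show "(path_image (\<gamma> f) - {pos s}) \<inter> ?J = {}" by blast
      have "q \<noteq> pos s" using q vJ st by auto
      then show "(path_image (\<gamma> f) - {pos s}) \<inter> inside ?J \<noteq> {}" using q by blast
    qed
    moreover have "pos t \<in> path_image (\<gamma> f) - {pos s}"
      using pos_in_edge[OF f, of t] pos_eq_iff[of s t] st by auto
    ultimately show False using vJ st by auto
  qed
  have DJ: "inside ?J \<inter> D = {}" using fJ vJ unfolding drawn_set_def by blast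
  have "inside ?J \<in> components (- D)"
    unfolding in_components_maximal
  proof (intro conjI allI impI)
    show ne: "inside ?J \<noteq> {}" and "connected (inside ?J)" using JJ by auto
    show "inside ?J \<subseteq> - D" using DJ by blast
    fix T assume T: "T \<noteq> {} \<and> inside ?J \<subseteq> T \<and> T \<subseteq> - D \<and> connected T"
    then have "T \<subseteq> inside ?J"
      using connected_subset_inside[of T ?J] JD ne by blast
    then show "T = inside ?J" using T by blast
  qed
  moreover have fr: "frontier (inside ?J) = ?J" and "bounded (inside ?J)"
    using JJ by - (elim conjE, assumption)+
  ultimately have "inside ?J \<in> inner_faces V E pos \<gamma>" unfolding inner_faces_def by (intro CollectI conjI)
  then have "marginal_triangle V E pos \<gamma> (inside ?J)"
    using striped unfolding striped_def internal_triangle_def by metis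
  then obtain e where e: "e \<in> E" "path_image (\<gamma> e) \<subseteq> frontier (inside ?J)"
    and e_out: "path_image (\<gamma> e) \<subseteq> frontier (outer_face V E pos \<gamma>)"
    unfolding marginal_triangle_def by blast
  \<comment> \<open>Points in the relative interior of an arc identify the edge.\<close>
  have e_pts: "path_image (\<gamma> e) - pos ` e \<noteq> {}"
    using open_arc_connected_nonempty(2)[OF arc_edge[OF e(1)] refl refl] unfolding ends_edge[OF e(1)] .
  have "e \<in> ?T"
  proof (rule ccontr)
    assume eT: "e \<notin> ?T"
    obtain q where q: "q \<in> path_image (\<gamma> e)" "q \<notin> pos ` e" using e_pts by blast
    have "q \<in> ?J" using e(2) q(1) unfolding fr by (rule subsetD)
    then obtain g where g: "g \<in> ?T" "q \<in> path_image (\<gamma> g)" by (rule UN_E)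
    have "g \<in> E" "e \<noteq> g" using g(1) TE eT by auto
    then show False using edges_meet[OF e(1), of g] q g(2) by blast
  qed
  moreover have "in_one_triangle E u v" if uv: "e = {u, v}" for u v
    unfolding in_one_triangle_def
  proof (intro allI impI, elim conjE, rule ccontr)
    fix w w'
    assume w: "{u, w} \<in> E" "{v, w} \<in> E" and w': "{u, w'} \<in> E" "{v, w'} \<in> E" and ww: "w \<noteq> w'"
    have uvE: "{u, v} \<in> E" using e(1) uv by simp
    have G: "gpath E (u # [w] @ [v])" "gpath E (u # [w'] @ [v])"
      using w w' edge_ends[OF w(1)] edge_ends[OF w(2)] edge_ends[OF w'(1)] edge_ends[OF w'(2)]
        edge_ends[OF uvE] by (simp_all add: gpath_def insert_commute)
    let ?K = "curve (u # [w] @ [v]) \<union> curve (u # [w'] @ [v])"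
    have "path_image (\<gamma> {u, v}) - {pos u, pos v} \<subseteq> inside ?K"
      by (rule chord_inside[OF G _ _ _ uvE]) (use ww in simp_all)
    then obtain q where q: "q \<in> path_image (\<gamma> e)" "q \<in> inside ?K"
      using e_pts unfolding uv by fast
    have "q \<notin> inside ?K"
    proof (rule outer_frontier_not_inside)
      show "q \<in> frontier (outer_face V E pos \<gamma>)" using e_out q(1) by (rule subsetD)
      show "closed ?K" using G by (intro closed_Un curve_closed)
      show "?K \<subseteq> D" using G by (intro Un_least curve_drawn)
    qed
    then show False using q(2) by contradiction
  qed
  ultimately show ?thesis by blast
qed

end

section \<open>Noncrossing layouts of outerplanar graphs\<close>

text \<open>
  The vertices are placed on a line. Reading the line as a circle cut open at one point, this says that
  the edges are pairwise noncrossing chords.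
\<close>

definition noncrossing :: "('a \<Rightarrow> real) \<Rightarrow> 'a set set \<Rightarrow> bool" where
  "noncrossing \<phi> E \<longleftrightarrow> (\<forall>u v x y. {u, v} \<in> E \<and> {x, y} \<in> E \<longrightarrow> \<not> (\<phi> u < \<phi> x \<and> \<phi> x < \<phi> v \<and> \<phi> v < \<phi> y))"

text \<open>
  Moves the vertices placed before \<open>t\<close> to the end; for \<open>K\<close> larger than the spread of the layout this
  cuts the circle open at \<open>t\<close> instead.
\<close>

definition rotated :: "real \<Rightarrow> real \<Rightarrow> ('a \<Rightarrow> real) \<Rightarrow> 'a \<Rightarrow> real" where
  "rotated t K \<phi> v = (if \<phi> v < t then \<phi> v + K else \<phi> v)"

lemma rotated_noncrossing:
  assumes nc: "noncrossing \<phi> E" and EV: "\<And>u v. {u, v} \<in> E \<Longrightarrow> u \<in> V \<and> v \<in> V"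
    and K: "\<And>u v. u \<in> V \<Longrightarrow> v \<in> V \<Longrightarrow> \<phi> u < \<phi> v + K"
  shows "noncrossing (rotated t K \<phi>) E"
  unfolding noncrossing_def
proof (intro allI impI notI, elim conjE)
  fix u v x y
  assume e: "{u, v} \<in> E" "{x, y} \<in> E"
    and lt: "rotated t K \<phi> u < rotated t K \<phi> x" "rotated t K \<phi> x < rotated t K \<phi> v"
      "rotated t K \<phi> v < rotated t K \<phi> y"
  have e': "{v, u} \<in> E" "{y, x} \<in> E" using e by (simp_all add: insert_commute)
  have V: "u \<in> V" "v \<in> V" "x \<in> V" "y \<in> V" using EV e by blast+
  have "\<not> (\<phi> u < \<phi> x \<and> \<phi> x < \<phi> v \<and> \<phi> v < \<phi> y)" "\<not> (\<phi> y < \<phi> u \<and> \<phi> u < \<phi> x \<and> \<phi> x < \<phi> v)"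
    "\<not> (\<phi> v < \<phi> y \<and> \<phi> y < \<phi> u \<and> \<phi> u < \<phi> x)" "\<not> (\<phi> x < \<phi> v \<and> \<phi> v < \<phi> y \<and> \<phi> y < \<phi> u)"
    using nc e e' unfolding noncrossing_def by blast+
  moreover have "\<phi> p < t \<and> \<phi> q < t \<and> \<phi> p < \<phi> q \<or> t \<le> \<phi> p \<and> t \<le> \<phi> q \<and> \<phi> p < \<phi> q \<or> t \<le> \<phi> p \<and> \<phi> q < t"
    if "rotated t K \<phi> p < rotated t K \<phi> q" "p \<in> V" "q \<in> V" for p q
    using that(1) K[OF that(3,2)] unfolding rotated_def by (simp split: if_splits)
  note this[OF lt(1)] this[OF lt(2)] this[OF lt(3)]
  ultimately show False using V by linarith
qed

lemma rotated_inj: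
  assumes "inj_on \<phi> V" and K: "\<And>u v. u \<in> V \<Longrightarrow> v \<in> V \<Longrightarrow> \<phi> u < \<phi> v + K"
  shows "inj_on (rotated t K \<phi>) V"
  using assms(1) K by (fastforce simp: inj_on_def rotated_def split: if_splits)

lemma spread_bound:
  assumes "finite V"
  obtains K :: real where "\<And>u v. u \<in> V \<Longrightarrow> v \<in> V \<Longrightarrow> \<phi> u < \<phi> v + K"
proof
  fix u v assume "u \<in> V" "v \<in> V"
  then have "\<phi> u \<le> Max (\<phi> ` V)" "Min (\<phi> ` V) \<le> \<phi> v" using assms by auto
  then show "\<phi> u < \<phi> v + (Max (\<phi> ` V) - Min (\<phi> ` V) + 1)" by simp
qed

text \<open>
  An edge counts as a cycle of length two. This gives the search for a longest cycle a place to start,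
  and extending such a cycle by a detour produces a genuine one.
\<close>

definition gcycle :: "'a set set \<Rightarrow> 'a list \<Rightarrow> bool" where
  "gcycle E zs \<longleftrightarrow> gpath E zs \<and> 2 \<le> length zs \<and> {hd zs, last zs} \<in> E"

lemma gcycle_rotate: "gcycle E (xs @ ys) \<Longrightarrow> gcycle E (ys @ xs)"
  by (cases "xs = []"; cases "ys = []")
    (auto simp: gcycle_def gpath_def successively_append_iff insert_commute)

lemma gcycle_split:
  assumes "gcycle E (a # X @ b # R)"
  shows "gpath E (a # X @ [b])" "gpath E (a # rev R @ [b])" "set X \<inter> set R = {}"
    "gpath E (b # R)" "a \<noteq> b" "a \<notin> set X" "a \<notin> set R" "b \<notin> set X" "b \<notin> set R" "{a, last (b # R)} \<in> E"
proof -
  have g: "gpath E ((a # X) @ b # R)" and e: "{a, last (b # R)} \<in> E"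
    using assms by (simp_all add: gcycle_def)
  then show 1: "gpath E (a # X @ [b])" "gpath E (b # R)" "{a, last (b # R)} \<in> E"
    using gpath_append[of E "a # X" b R] by simp_all
  from g show d: "set X \<inter> set R = {}" "a \<noteq> b" "a \<notin> set X" "a \<notin> set R" "b \<notin> set X" "b \<notin> set R"
    by (auto simp: gpath_def)
  have "gpath E (rev R @ [b])" using 1(2) gpath_rev[of E "b # R"] by simp
  moreover have "hd (rev R @ [b]) = last (b # R)" by (simp add: hd_append hd_rev)
  ultimately show "gpath E (a # rev R @ [b])"
    using e d by (simp add: gpath_def successively_Cons)
qed

lemma hamiltonian_noncrossing:
  assumes cyc: "gcycle E zs" and V: "\<And>u v. {u, v} \<in> E \<Longrightarrow> u \<in> set zs \<and> v \<in> set zs"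
    and nc: "no_crossing_chords E" and srt: "sorted_wrt (\<lambda>u v. \<phi> u < \<phi> v) zs"
  shows "noncrossing \<phi> E"
  unfolding noncrossing_def
proof (intro allI impI notI, elim conjE)
  fix u v x y
  assume e: "{u, v} \<in> E" "{x, y} \<in> E" and lt: "\<phi> u < \<phi> x" "\<phi> x < \<phi> v" "\<phi> v < \<phi> y"
  have "u \<in> set zs" using V e by blast
  then obtain A B where AB: "zs = A @ u # B" using split_list by metis
  have "v \<in> set B" using V[OF e(1)] srt lt AB by (auto simp: sorted_wrt_append)
  then obtain X C where XC: "B = X @ v # C" using split_list by metis
  have "x \<in> set X" using V[OF e(2)] srt lt AB XC by (auto simp: sorted_wrt_append)
  have "y \<in> set C" using V[OF e(2)] srt lt AB XC by (auto simp: sorted_wrt_append)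
  have "gcycle E (u # X @ v # C @ A)" using cyc gcycle_rotate[of E A "u # B"] AB XC by simp
  note sp = gcycle_split[OF this]
  have "set X \<inter> set (rev (C @ A)) = {}" using sp(3) by auto
  moreover have "y \<in> set (rev (C @ A))" using \<open>y \<in> set C\<close> by simp
  ultimately show False using no_crossing_chordsD[OF nc sp(1,2) _ e(1), of x y] e(2) \<open>x \<in> set X\<close> by blast
qed

lemma path_around:
  assumes "(w, w') \<in> {(u, v). {u, v} \<in> E \<and> u \<notin> S \<and> v \<notin> S}\<^sup>*" "w \<notin> S"
  shows "\<exists>Q. Q \<noteq> [] \<and> hd Q = w \<and> last Q = w' \<and> gpath E Q \<and> set Q \<inter> S = {}"
  using assms
proof (induction rule: rtrancl_induct)
  case base then show ?case by (intro exI[of _ "[w]"]) (simp add: gpath_def)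
next
  case (step y z)
  then obtain Q where Q: "Q \<noteq> []" "hd Q = w" "last Q = y" "gpath E Q" "set Q \<inter> S = {}" by auto
  show ?case
  proof (cases "z \<in> set Q")
    case True
    then obtain A B where AB: "Q = A @ z # B" using split_list by metis
    then have "gpath E (A @ [z])" "hd (A @ [z]) = w" using Q gpath_append[of E A z B]
      by (auto simp: hd_append)
    then show ?thesis using Q(5) AB by (intro exI[of _ "A @ [z]"]) auto
  next
    case False
    then show ?thesis using Q step.hyps
      by (intro exI[of _ "Q @ [z]"]) (auto simp: gpath_def successively_append_iff)
  qed
qed

text \<open>
  A detour \<open>P\<close> from \<open>c\<close> to \<open>c'\<close> off the cycle competes with the two arcs of the cycle between these
  vertices. If one of the arcs has no inner vertex, \<open>P\<close> replaces it and lengthens the cycle; otherwise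
  the three paths form a forbidden theta.
\<close>

lemma longer_cycle:
  assumes cyc: "gcycle E zs" and nt: "no_theta E"
    and c: "c \<in> set zs" "c' \<in> set zs" "c \<noteq> c'"
    and P: "gpath E (c # P @ [c'])" "P \<noteq> []" "set P \<inter> set zs = {}"
  shows "\<exists>zs'. gcycle E zs' \<and> length zs < length zs'"
proof -
  obtain A R where AR: "zs = A @ c # R" using c(1) split_list by metis
  have "c' \<in> set (R @ A)" using c AR by auto
  then obtain B F where BF: "R @ A = B @ c' # F" using split_list by metis
  have cyc': "gcycle E (c # B @ c' # F)" using cyc gcycle_rotate[of E A "c # R"] AR BF by simp
  have set_zs: "set zs = set (c # B @ c' # F)" using AR BF by (metis append_Cons set_append sup_commute)
  have len: "length zs = length (c # B @ c' # F)" using AR BF by (metis append_Cons length_append add.commute)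
  note sp = gcycle_split[OF cyc']
  have disj: "set P \<inter> set B = {}" "set P \<inter> set F = {}" "c \<notin> set P" "c' \<notin> set P"
    using P(3) set_zs by auto
  consider "B = []" | "F = []" | "B \<noteq> []" "F \<noteq> []" by blast
  then show ?thesis
  proof cases
    case 1
    have "gpath E ((c # P) @ c' # F)" using gpath_append[of E "c # P" c' F] P sp disj by simp
    then have "gcycle E (c # P @ c' # F)" using sp(10) by (simp add: gcycle_def)
    moreover have "length zs < length (c # P @ c' # F)" using len 1 P(2) by simp
    ultimately show ?thesis by blast
  next
    case 2
    have "gpath E (rev (c # P @ [c']))" using P(1) gpath_rev by blast
    then have "gpath E ((c' # rev P) @ [c])" by simp
    then have "gpath E (c' # rev P)" unfolding gpath_def successively_append_iff by simp
    then have "gpath E ((c # B) @ c' # rev P)"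
      using gpath_append[of E "c # B" c' "rev P"] sp disj by auto
    moreover have "{c, hd P} \<in> E" using P(1,2) by (cases P) (auto simp: gpath_def)
    ultimately have "gcycle E (c # B @ c' # rev P)" using P(2) by (simp add: gcycle_def last_rev)
    moreover have "length zs < length (c # B @ c' # rev P)" using len 2 P(2) by simp
    ultimately show ?thesis by blast
  next
    case 3
    have "set B \<inter> set (rev F) = {}" "set B \<inter> set P = {}" "set (rev F) \<inter> set P = {}"
      using sp disj by auto
    then show ?thesis using no_thetaD[OF nt sp(1,2) P(1)] 3 P(2) by simp
  qed
qed

text \<open>
  Cutting the circle open just before \<open>c\<close> makes \<open>c\<close> the first vertex.
\<close>

lemma rooted_layout:
  assumes "noncrossing \<phi> E" "inj_on \<phi> V" "finite V" "c \<in> V" "\<And>u v. {u, v} \<in> E \<Longrightarrow> u \<in> V \<and> v \<in> V"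
  obtains \<psi> where "noncrossing \<psi> E" "inj_on \<psi> V" "\<psi> c = 0" "\<And>v. v \<in> V \<Longrightarrow> v \<noteq> c \<Longrightarrow> 0 < \<psi> v"
proof -
  obtain K where K: "\<And>u v. u \<in> V \<Longrightarrow> v \<in> V \<Longrightarrow> \<phi> u < \<phi> v + K" using spread_bound[OF assms(3)] by blast
  let ?\<psi> = "\<lambda>v. rotated (\<phi> c) K \<phi> v - \<phi> c"
  have "noncrossing ?\<psi> E" using rotated_noncrossing[OF assms(1,5) K] by (simp add: noncrossing_def)
  moreover have "inj_on ?\<psi> V" using rotated_inj[OF assms(2) K] by (simp add: inj_on_def)
  moreover have "?\<psi> c = 0" by (simp add: rotated_def)
  moreover have "0 < ?\<psi> v" if "v \<in> V" "v \<noteq> c" for v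
  proof -
    have "\<phi> v \<noteq> \<phi> c" using that assms(2,4) by (auto simp: inj_on_def)
    then show ?thesis using K[OF assms(4) that(1)] by (auto simp: rotated_def)
  qed
  ultimately show thesis using that by blast
qed

text \<open>
  Root both layouts at \<open>c\<close> and place \<open>c\<close> at the origin, \<open>B\<close> to its right and the mirror image of \<open>A\<close>
  to its left. Edges on different sides of the origin do not interleave.
\<close>

lemma glued_layout:
  assumes AB: "A \<inter> B = {c}" and fin: "finite A" "finite B"
    and E: "\<And>e. e \<in> E \<Longrightarrow> e \<subseteq> A \<or> e \<subseteq> B"
    and A: "inj_on \<phi>A A" "noncrossing \<phi>A {e \<in> E. e \<subseteq> A}"
    and B: "inj_on \<phi>B B" "noncrossing \<phi>B {e \<in> E. e \<subseteq> B}"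
  shows "\<exists>\<phi>. inj_on \<phi> (A \<union> B) \<and> noncrossing \<phi> E"
proof -
  have cAB: "c \<in> A" "c \<in> B" using AB by auto
  obtain \<alpha> where \<alpha>: "noncrossing \<alpha> {e \<in> E. e \<subseteq> A}" "inj_on \<alpha> A" "\<alpha> c = 0" "\<And>v. v \<in> A \<Longrightarrow> v \<noteq> c \<Longrightarrow> 0 < \<alpha> v"
    using rooted_layout[OF A(2,1) fin(1) cAB(1)] by auto
  obtain \<beta> where \<beta>: "noncrossing \<beta> {e \<in> E. e \<subseteq> B}" "inj_on \<beta> B" "\<beta> c = 0" "\<And>v. v \<in> B \<Longrightarrow> v \<noteq> c \<Longrightarrow> 0 < \<beta> v"
    using rooted_layout[OF B(2,1) fin(2) cAB(2)] by auto
  define \<phi> where "\<phi> v = (if v \<in> A then - \<alpha> v else \<beta> v)" for v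
  have \<phi>A: "\<phi> v = - \<alpha> v" "\<phi> v \<le> 0" if "v \<in> A" for v
    using that \<alpha>(3) \<alpha>(4)[of v] by (cases "v = c"; simp add: \<phi>_def)+
  have \<phi>B: "\<phi> v = \<beta> v" "0 \<le> \<phi> v" if "v \<in> B" for v
  proof -
    have "v \<in> A \<Longrightarrow> v = c" using that AB by blast
    then show "\<phi> v = \<beta> v" "0 \<le> \<phi> v" using that \<alpha>(3) \<beta>(3) \<beta>(4)[of v] by (cases "v = c"; force simp: \<phi>_def)+
  qed
  have pos: "0 < \<phi> v" if "v \<in> B" "v \<notin> A" for v using \<phi>B that \<beta>(4)[of v] cAB by auto
  have "inj_on \<phi> (A \<union> B)"
  proof (rule inj_onI)
    fix u v assume uv: "u \<in> A \<union> B" "v \<in> A \<union> B" "\<phi> u = \<phi> v"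
    consider "u \<in> A" "v \<in> A" | "u \<in> B" "v \<in> B" | "u \<in> A" "v \<in> B" "v \<notin> A" | "v \<in> A" "u \<in> B" "u \<notin> A"
      using uv by blast
    then show "u = v"
    proof cases
      case 1 then show ?thesis using uv \<phi>A \<alpha>(2) by (auto simp: inj_on_def)
    next
      case 2 then show ?thesis using uv \<phi>B \<beta>(2) by (auto simp: inj_on_def)
    next
      case 3 then show ?thesis using uv(3) \<phi>A(2)[of u] pos[of v] by auto
    next
      case 4 then show ?thesis using uv(3) \<phi>A(2)[of v] pos[of u] by auto
    qed
  qed
  moreover have "noncrossing \<phi> E"
    unfolding noncrossing_def
  proof (intro allI impI notI, elim conjE)
    fix u v x y
    assume e: "{u, v} \<in> E" "{x, y} \<in> E" and lt: "\<phi> u < \<phi> x" "\<phi> x < \<phi> v" "\<phi> v < \<phi> y"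
    consider "u \<in> A" "v \<in> A" "x \<in> A" "y \<in> A" | "u \<in> B" "v \<in> B" "x \<in> B" "y \<in> B"
      | "v \<in> A" "x \<in> B" | "u \<in> B" "x \<in> A"
      using E[OF e(1)] E[OF e(2)] by auto
    then show False
    proof cases
      case 1
      then have "{y, x} \<in> {e \<in> E. e \<subseteq> A}" "{v, u} \<in> {e \<in> E. e \<subseteq> A}" using e by (auto simp: insert_commute)
      moreover have "\<alpha> y < \<alpha> v" "\<alpha> v < \<alpha> x" "\<alpha> x < \<alpha> u" using lt \<phi>A 1 by auto
      ultimately show False using \<alpha>(1) unfolding noncrossing_def by blast
    next
      case 2
      then have "{u, v} \<in> {e \<in> E. e \<subseteq> B}" "{x, y} \<in> {e \<in> E. e \<subseteq> B}" using e by auto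
      moreover have "\<beta> u < \<beta> x" "\<beta> x < \<beta> v" "\<beta> v < \<beta> y" using lt \<phi>B 2 by auto
      ultimately show False using \<beta>(1) unfolding noncrossing_def by blast
    next
      case 3 then show False using \<phi>A(2)[of v] \<phi>B(2)[of x] lt by auto
    next
      case 4 then show False using \<phi>A(2)[of x] \<phi>B(2)[of u] lt by auto
    qed
  qed
  ultimately show ?thesis by blast
qed

text \<open>
  Induction on the number of vertices. A longest cycle through all vertices is itself a layout. If it
  misses a vertex, let \<open>W\<close> be the component of that vertex off the cycle. By \<open>longer_cycle\<close>, \<open>W\<close> is
  attached to at most one vertex \<open>c\<close> of the cycle, so \<open>insert c W\<close> and the complement of \<open>W\<close> are two
  smaller graphs meeting in \<open>c\<close> alone, whose layouts are glued together.
\<close>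

lemma noncrossing_layout:
  assumes "simple_graph V E" "no_theta E" "no_crossing_chords E"
  shows "\<exists>\<phi>. inj_on \<phi> V \<and> noncrossing \<phi> E"
  using assms
proof (induction "card V" arbitrary: V E rule: less_induct)
  case less
  note simple = less.prems(1) and nt = less.prems(2) and ncc = less.prems(3)
  have finV: "finite V" and EV: "\<And>e. e \<in> E \<Longrightarrow> e \<subseteq> V" and E2: "\<And>e. e \<in> E \<Longrightarrow> card e = 2"
    using simple by (auto simp: simple_graph_def)
  have edge: "u \<in> V \<and> v \<in> V \<and> u \<noteq> v" if "{u, v} \<in> E" for u v
    using EV[OF that] E2[OF that] by auto
  show ?case
  proof (cases "E = {}")
    case True
    obtain xs where "set xs = V" "distinct xs" using finite_distinct_list[OF finV] by blast
    then show ?thesis using ranking[of xs] sorted_wrt_inj True by (fastforce simp: noncrossing_def)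
  next
    case False
    then obtain a b where ab: "{a, b} \<in> E" using E2 by (metis card_2_iff equals0I)
    then have "gcycle E [a, b]" using edge[OF ab] by (simp add: gcycle_def gpath_def)
    have cycV: "set zs \<subseteq> V" if "gcycle E zs" for zs
    proof
      fix v assume "v \<in> set zs"
      moreover have "2 \<le> length zs" using that by (simp add: gcycle_def)
      ultimately obtain e where "e \<in> path_edges zs" "v \<in> e"
        using set_subset_path_edges[of zs v] by blast
      then show "v \<in> V" using gpath_edges[of E zs] that EV by (auto simp: gcycle_def)
    qed
    have "length zs < Suc (card V)" if "gcycle E zs" for zs
    proof -
      have "distinct zs" using that by (simp add: gcycle_def gpath_def)
      then show ?thesis using card_mono[OF finV cycV[OF that]] by (simp add: distinct_card)
    qed
    then obtain zs where zs: "gcycle E zs" and longest: "\<And>zs'. gcycle E zs' \<Longrightarrow> length zs' \<le> length zs"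
      using ex_has_greatest_nat[of "gcycle E" "[a, b]" length "Suc (card V)"] \<open>gcycle E [a, b]\<close> 
      by (metis less_imp_le_nat)
    have dzs: "distinct zs" using zs by (simp add: gcycle_def gpath_def)
    show ?thesis
    proof (cases "set zs = V")
      case True
      obtain \<phi> :: "'a \<Rightarrow> real" where "sorted_wrt (\<lambda>u v. \<phi> u < \<phi> v) zs" using ranking[OF dzs] by blast
      then show ?thesis
        using hamiltonian_noncrossing[OF zs _ ncc] edge sorted_wrt_inj True by blast
    next
      case False
      let ?S = "set zs"
      let ?R = "{(u, v). {u, v} \<in> E \<and> u \<notin> ?S \<and> v \<notin> ?S}"
      obtain w0 where w0: "w0 \<in> V" "w0 \<notin> ?S" using False cycV[OF zs] by blast
      define W where "W = {w. (w0, w) \<in> ?R\<^sup>*}"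
      have W_step: "v \<in> W" if "u \<in> W" "{u, v} \<in> E" "u \<notin> ?S" "v \<notin> ?S" for u v
        using that unfolding W_def by (auto intro: rtrancl_into_rtrancl)
      have W: "w \<in> V \<and> w \<notin> ?S" if "w \<in> W" for w
        using that[unfolded W_def mem_Collect_eq] by (induction rule: rtrancl_induct) (use w0 edge in auto)
      have sym: "sym (?R\<^sup>*)" by (intro sym_rtrancl symI) (auto simp: insert_commute)
      have one: "c = c'" if att: "{w, c} \<in> E" "w \<in> W" "c \<in> ?S" "{w', c'} \<in> E" "w' \<in> W" "c' \<in> ?S" for w c w' c'
      proof (rule ccontr)
        assume ne: "c \<noteq> c'"
        have "(w, w0) \<in> ?R\<^sup>*" "(w0, w') \<in> ?R\<^sup>*"
          using symD[OF sym, of w0 w] att(2,5) unfolding W_def by simp_all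
        then have "(w, w') \<in> ?R\<^sup>*" by (rule rtrancl_trans)
        then obtain Q where Q: "Q \<noteq> []" "hd Q = w" "last Q = w'" "gpath E Q" "set Q \<inter> ?S = {}"
          using path_around[of w w' E ?S] W[OF att(2)] by blast
        moreover have "{c, w} \<in> E" using att(1) by (simp add: insert_commute)
        ultimately have "gpath E (c # Q @ [c'])"
          using att(3,4,6) ne by (auto simp: gpath_def successively_Cons successively_append_iff)
        from longer_cycle[OF zs nt att(3,6) ne this Q(1,5)] show False using longest by fastforce
      qed
      \<comment> \<open>If \<open>W\<close> is not attached to the cycle at all, any vertex of the cycle serves as \<open>c\<close>.\<close>
      obtain c where c: "c \<in> ?S" "\<And>w x. {w, x} \<in> E \<Longrightarrow> w \<in> W \<Longrightarrow> x \<in> ?S \<Longrightarrow> x = c"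
      proof (cases "\<exists>w x. {w, x} \<in> E \<and> w \<in> W \<and> x \<in> ?S")
        case True then show ?thesis using that one by metis
      next
        case False
        have "zs \<noteq> []" using zs by (auto simp: gcycle_def)
        then have "hd zs \<in> ?S" by simp
        then show ?thesis using that False by blast
      qed
      let ?A = "insert c W" and ?B = "V - W"
      have cV: "c \<in> V" "c \<notin> W" using c(1) cycV[OF zs] W by blast+
      have AB: "?A \<inter> ?B = {c}" using cV by auto
      have ABV: "?A \<union> ?B = V" using cV W by auto
      have "card {c} < card ?S" using zs dzs distinct_card[of zs] by (simp add: gcycle_def)
      then obtain c2 where c2: "c2 \<in> ?S" "c2 \<noteq> c"
        by (metis card_mono finite.emptyI finite.insertI not_le singletonI subsetI)
      have "?A \<subset> V" using c2 W cV cycV[OF zs] by blast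
      then have cA: "card ?A < card V" using finV by (rule psubset_card_mono[rotated])
      have "w0 \<in> W" by (simp add: W_def)
      then have "?B \<subset> V" using w0 by blast
      then have cB: "card ?B < card V" using finV by (rule psubset_card_mono[rotated])
      have fin: "finite ?A" "finite ?B" using finV ABV by (metis finite_Un)+
      have E_AB: "e \<subseteq> ?A \<or> e \<subseteq> ?B" if "e \<in> E" for e
      proof -
        obtain u v where uv: "e = {u, v}" using E2[OF \<open>e \<in> E\<close>] by (auto simp: card_2_iff)
        have e: "{u, v} \<in> E" "{v, u} \<in> E" using that uv by (auto simp: insert_commute)
        have "v \<in> ?A" if "u \<in> W" using W_step[OF that e(1)] W[OF that] c(2)[OF e(1) that] by auto
        moreover have "u \<in> ?A" if "v \<in> W" using W_step[OF that e(2)] W[OF that] c(2)[OF e(2) that] by auto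
        ultimately show ?thesis using edge[OF e(1)] uv by auto
      qed
      have sub: "\<exists>\<phi>. inj_on \<phi> U \<and> noncrossing \<phi> {e \<in> E. e \<subseteq> U}" if "card U < card V" "finite U" for U
        using less.hyps[OF that(1), of "{e \<in> E. e \<subseteq> U}"] no_theta_mono[OF nt, of "{e \<in> E. e \<subseteq> U}"]
          no_crossing_chords_mono[OF ncc, of "{e \<in> E. e \<subseteq> U}"] that(2) E2
        by (auto simp: simple_graph_def)
      obtain \<phi>A where "inj_on \<phi>A ?A" "noncrossing \<phi>A {e \<in> E. e \<subseteq> ?A}" using sub[OF cA fin(1)] by blast
      moreover obtain \<phi>B where "inj_on \<phi>B ?B" "noncrossing \<phi>B {e \<in> E. e \<subseteq> ?B}" using sub[OF cB fin(2)] by blast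
      ultimately have "\<exists>\<phi>. inj_on \<phi> (?A \<union> ?B) \<and> noncrossing \<phi> E"
        using glued_layout[OF AB fin E_AB] by blast
      then show ?thesis unfolding ABV .
    qed
  qed
qed

section \<open>Noncrossing layouts are drawn with straight lines\<close>

definition parabola :: "real \<Rightarrow> complex" where
  "parabola t = Complex t (t\<^sup>2)"

lemma parabola_inj: "parabola s = parabola t \<longleftrightarrow> s = t"
  by (auto simp: parabola_def)

text \<open>
  The last equation measures how far the chord runs above the parabola; it turns the intersection of
  chords into an equation between two quadratic polynomials.
\<close>

lemma parabola_chord:
  assumes "z \<in> closed_segment (parabola a) (parabola b)" "a < b"
  shows "a \<le> Re z" "Re z \<le> b" "Im z - (Re z)\<^sup>2 = (Re z - a) * (b - Re z)"
proof -
  obtain s where s: "0 \<le> s" "s \<le> 1" "z = (1 - s) *\<^sub>R parabola a + s *\<^sub>R parabola b"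
    using assms(1) by (auto simp: in_segment)
  have re: "Re z = a + s * (b - a)" and im: "Im z = (1 - s) * a\<^sup>2 + s * b\<^sup>2"
    unfolding s(3) by (simp_all add: parabola_def algebra_simps)
  show "a \<le> Re z" using re s assms(2) by simp
  have "s * (b - a) \<le> 1 * (b - a)" using s assms(2) by (intro mult_right_mono) auto
  then show "Re z \<le> b" using re by simp
  show "Im z - (Re z)\<^sup>2 = (Re z - a) * (b - Re z)"
    unfolding re im by (simp add: algebra_simps power2_eq_square)
qed

text \<open>
  The right-hand side of the quadratic equation never exceeds the left-hand side on the interval
  \<open>[c, d]\<close>, and their difference is a sum of two nonnegative products, which both have to vanish.
\<close>

lemma nested_chords_meet:
  fixes x :: real
  assumes "a \<le> c" "d \<le> b" "c \<le> x" "x \<le> d" "(x - a) * (b - x) = (x - c) * (d - x)" "\<not> (a = c \<and> b = d)"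
  shows "x = a \<and> x = c \<or> x = b \<and> x = d"
proof -
  have "(x - a) * (b - d) + (c - a) * (d - x) = 0" using assms(5) by (simp add: algebra_simps)
  moreover have "0 \<le> (x - a) * (b - d)" "0 \<le> (c - a) * (d - x)" using assms by simp_all
  ultimately have "(x - a) * (b - d) = 0" "(c - a) * (d - x) = 0" by linarith+
  then show ?thesis using assms by auto
qed

text \<open>
  Two intervals that do not interleave are nested or have at most an end point in common.
\<close>

lemma parabola_chords_meet:
  assumes "z \<in> closed_segment (parabola a) (parabola b)" "a < b"
    and "z \<in> closed_segment (parabola c) (parabola d)" "c < d"
    and "\<not> (a < c \<and> c < b \<and> b < d)" "\<not> (c < a \<and> a < d \<and> d < b)" "\<not> (a = c \<and> b = d)"
  shows "\<exists>r \<in> {a, b} \<inter> {c, d}. z = parabola r"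
proof -
  note ab = parabola_chord[OF assms(1,2)] and cd = parabola_chord[OF assms(3,4)]
  have eq: "(Re z - a) * (b - Re z) = (Re z - c) * (d - Re z)" using ab(3) cd(3) by simp
  have "Re z = a \<and> Re z = c \<or> Re z = b \<and> Re z = d \<or> Re z = b \<and> Re z = c \<or> Re z = a \<and> Re z = d"
  proof -
    consider "b \<le> c" | "d \<le> a" | "a \<le> c" "d \<le> b" | "c \<le> a" "b \<le> d" using assms(5,6) by linarith
    then show ?thesis
    proof cases
      case 1 then show ?thesis using ab cd by linarith
    next
      case 2 then show ?thesis using ab cd by linarith
    next
      case 3 then show ?thesis using nested_chords_meet[OF 3 cd(1,2) eq assms(7)] by blast
    next
      case 4 then show ?thesis using nested_chords_meet[OF 4 ab(1,2) eq[symmetric]] assms(7) by blast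
    qed
  qed
  then have r: "Re z \<in> {a, b} \<inter> {c, d}" by auto
  then have "Im z - (Re z)\<^sup>2 = 0" using ab(3) by auto
  then have "z = parabola (Re z)" by (simp add: parabola_def complex_eq_iff)
  then show ?thesis using r by blast
qed

definition above_parabola :: "complex set" where
  "above_parabola = {z. (Re z)\<^sup>2 \<le> Im z}"

lemma convex_above_parabola: "convex above_parabola"
  unfolding convex_alt
proof (intro ballI allI impI)
  fix z w and s :: real
  assume zw: "z \<in> above_parabola" "w \<in> above_parabola" and s: "0 \<le> s \<and> s \<le> 1"
  have "((1 - s) * Re z + s * Re w)\<^sup>2 = (1 - s) * (Re z)\<^sup>2 + s * (Re w)\<^sup>2 - s * (1 - s) * (Re z - Re w)\<^sup>2"
    by (simp add: algebra_simps power2_eq_square)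
  also have "\<dots> \<le> (1 - s) * (Re z)\<^sup>2 + s * (Re w)\<^sup>2" using s by simp
  also have "\<dots> \<le> (1 - s) * Im z + s * Im w"
    using zw s by (intro add_mono mult_left_mono) (auto simp: above_parabola_def)
  finally show "(1 - s) *\<^sub>R z + s *\<^sub>R w \<in> above_parabola" by (simp add: above_parabola_def)
qed

text \<open>
  The complement of the convex set above the parabola lies outside any drawing within that set and
  comes arbitrarily close to each point of the parabola.
\<close>

lemma parabola_in_frontier:
  assumes "S \<subseteq> above_parabola" "parabola t \<in> S"
  shows "parabola t \<in> frontier (outside S)"
proof -
  have "parabola t \<in> closure (- above_parabola)"
    unfolding closure_approachable
  proof (intro allI impI)
    fix e :: real assume e: "0 < e"
    have "Complex t (t\<^sup>2 - e / 2) \<in> - above_parabola" using e by (simp add: above_parabola_def)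
    moreover have "dist (Complex t (t\<^sup>2 - e / 2)) (parabola t) < e"
      using e by (simp add: dist_norm parabola_def complex_diff cmod_def)
    ultimately show "\<exists>y\<in>- above_parabola. dist y (parabola t) < e" by blast
  qed
  moreover have "- above_parabola \<subseteq> outside S"
    using outside_mono[OF assms(1)] outside_convex[OF convex_above_parabola] by simp
  ultimately have "parabola t \<in> closure (outside S)" using closure_mono by blast
  moreover have "parabola t \<notin> interior (outside S)"
    using assms(2) interior_subset outside_no_overlap[of S] by blast
  ultimately show ?thesis by (simp add: frontier_def)
qed

text \<open>
  With the vertices on a strictly convex curve, segments that do not interleave meet only in common end
  points, and every vertex is visible from below.
\<close>

lemma noncrossing_outerplanar:
  assumes simple: "simple_graph V E" and inj: "inj_on \<phi> V" and nc: "noncrossing \<phi> E"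
  shows "outerplanar V E"
proof -
  define pos where "pos v = parabola (\<phi> v)" for v
  define \<gamma> where "\<gamma> e = linepath (parabola (Min (\<phi> ` e))) (parabola (Max (\<phi> ` e)))" for e
  have edge: "\<exists>u v. e = {u, v} \<and> u \<in> V \<and> v \<in> V \<and> \<phi> u < \<phi> v \<and> \<gamma> e = linepath (pos u) (pos v)"
    if e: "e \<in> E" for e
  proof -
    obtain u v where uv: "e = {u, v}" "u \<noteq> v" "u \<in> V" "v \<in> V"
      using simple e unfolding simple_graph_def by (fastforce simp: card_2_iff)
    then have "\<phi> u \<noteq> \<phi> v" using inj by (auto simp: inj_on_def)
    then consider "\<phi> u < \<phi> v" | "\<phi> v < \<phi> u" by linarith
    then show ?thesis
    proof cases
      case 1
      then show ?thesis using uv by (intro exI[of _ u] exI[of _ v]) (simp add: \<gamma>_def pos_def)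
    next
      case 2
      then show ?thesis using uv
        by (intro exI[of _ v] exI[of _ u]) (simp add: \<gamma>_def pos_def insert_commute)
    qed
  qed
  have pos_inj: "inj_on pos V" using inj by (simp add: inj_on_def pos_def parabola_inj)
  have "plane_drawing V E pos \<gamma>"
    unfolding plane_drawing_def
  proof (intro conjI ballI impI)
    show "inj_on pos V" by (rule pos_inj)
  next
    fix e assume "e \<in> E"
    then obtain u v where uv: "e = {u, v}" "u \<in> V" "v \<in> V" "\<phi> u < \<phi> v" "\<gamma> e = linepath (pos u) (pos v)"
      using edge by blast
    show "arc (\<gamma> e)" using uv by (auto simp: pos_def parabola_inj)
    show "{pathstart (\<gamma> e), pathfinish (\<gamma> e)} = pos ` e" using uv by simp
    show "path_image (\<gamma> e) \<inter> pos ` V \<subseteq> pos ` e"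
    proof
      fix z assume "z \<in> path_image (\<gamma> e) \<inter> pos ` V"
      then obtain w where w: "w \<in> V" "z = pos w"
        "z \<in> closed_segment (parabola (\<phi> u)) (parabola (\<phi> v))"
        using uv by (auto simp: pos_def)
      have "(\<phi> w - \<phi> u) * (\<phi> v - \<phi> w) = 0"
        using parabola_chord(3)[OF w(3) uv(4)] w(2) by (simp add: pos_def parabola_def)
      then have "\<phi> w = \<phi> u \<or> \<phi> w = \<phi> v" by auto
      then show "z \<in> pos ` e" using uv w by (auto simp: pos_def)
    qed
  next
    fix e f assume ef: "e \<in> E" "f \<in> E" "e \<noteq> f"
    obtain u v where uv: "e = {u, v}" "u \<in> V" "v \<in> V" "\<phi> u < \<phi> v" "\<gamma> e = linepath (pos u) (pos v)"
      using edge[OF ef(1)] by blast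
    obtain x y where xy: "f = {x, y}" "x \<in> V" "y \<in> V" "\<phi> x < \<phi> y" "\<gamma> f = linepath (pos x) (pos y)"
      using edge[OF ef(2)] by blast
    have eq: "p = q" if "\<phi> p = \<phi> q" "p \<in> V" "q \<in> V" for p q
      using that inj by (auto simp: inj_on_def)
    show "path_image (\<gamma> e) \<inter> path_image (\<gamma> f) \<subseteq> pos ` (e \<inter> f)"
    proof
      fix z assume "z \<in> path_image (\<gamma> e) \<inter> path_image (\<gamma> f)"
      then have z: "z \<in> closed_segment (parabola (\<phi> u)) (parabola (\<phi> v))"
        "z \<in> closed_segment (parabola (\<phi> x)) (parabola (\<phi> y))" using uv xy by (simp_all add: pos_def)
      have n1: "\<not> (\<phi> u < \<phi> x \<and> \<phi> x < \<phi> v \<and> \<phi> v < \<phi> y)" and n2: "\<not> (\<phi> x < \<phi> u \<and> \<phi> u < \<phi> y \<and> \<phi> y < \<phi> v)"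
        using nc ef uv(1) xy(1) unfolding noncrossing_def by blast+
      have n3: "\<not> (\<phi> u = \<phi> x \<and> \<phi> v = \<phi> y)" using eq ef(3) uv xy by blast
      obtain r where r: "r \<in> {\<phi> u, \<phi> v} \<inter> {\<phi> x, \<phi> y}" "z = parabola r"
        using parabola_chords_meet[OF z(1) uv(4) z(2) xy(4) n1 n2 n3] by blast
      have "r \<in> \<phi> ` {u, v}" "r \<in> \<phi> ` {x, y}" using r(1) by auto
      then obtain p q where p: "p \<in> {u, v}" "r = \<phi> p" and q: "q \<in> {x, y}" "r = \<phi> q"
        by (elim imageE)
      have "p \<in> V" "q \<in> V" using p(1) q(1) uv(2,3) xy(2,3) by auto
      then have "p = q" using eq[of p q] p(2) q(2) by simp
      then have "p \<in> e \<inter> f" using p(1) q(1) uv(1) xy(1) by simp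
      moreover have "z = pos p" using r(2) p(2) by (simp add: pos_def)
      ultimately show "z \<in> pos ` (e \<inter> f)" by blast
    qed
  qed
  moreover have "pos ` V \<subseteq> frontier (outer_face V E pos \<gamma>)"
  proof -
    have on: "pos v \<in> above_parabola" for v by (simp add: pos_def parabola_def above_parabola_def)
    have "path_image (\<gamma> e) \<subseteq> above_parabola" if e: "e \<in> E" for e
    proof -
      obtain u v where "\<gamma> e = linepath (pos u) (pos v)" using edge[OF e] by blast
      then show ?thesis using on convex_above_parabola by (simp add: closed_segment_subset)
    qed
    then have sub: "drawn_set V E pos \<gamma> \<subseteq> above_parabola" using on by (auto simp: drawn_set_def)
    show ?thesis
    proof
      fix z assume "z \<in> pos ` V"
      then obtain v where v: "v \<in> V" "z = parabola (\<phi> v)" by (auto simp: pos_def)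
      then have "parabola (\<phi> v) \<in> drawn_set V E pos \<gamma>" by (auto simp: drawn_set_def pos_def)
      then show "z \<in> frontier (outer_face V E pos \<gamma>)"
        unfolding v(2) outer_face_def using parabola_in_frontier[OF sub] by blast
    qed
  qed
  ultimately show ?thesis unfolding outerplanar_def outerplane_drawing_def by blast
qed

lemma simple_insert: "simple_graph V E \<Longrightarrow> u \<in> V \<Longrightarrow> v \<in> V \<Longrightarrow> u \<noteq> v \<Longrightarrow> simple_graph V (insert {u, v} E)"
  by (simp add: simple_graph_def)

section \<open>Striped triangulated polygons\<close>

text \<open>
  What remains of the drawing: a noncrossing layout, maximality with respect to all noncrossing layouts,
  and the outer edge of each triangle. Quantifying maximality over all layouts makes the assumptions
  stable under rotating the layout.
\<close>

locale striped_polygon =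
  fixes V :: "'a set" and E :: "'a set set" and \<phi> :: "'a \<Rightarrow> real"
  assumes simple: "simple_graph V E"
    and inj: "inj_on \<phi> V"
    and noncrossing: "noncrossing \<phi> E"
    and maximal: "\<And>u v \<psi> :: 'a \<Rightarrow> real. u \<in> V \<Longrightarrow> v \<in> V \<Longrightarrow> u \<noteq> v \<Longrightarrow> {u, v} \<notin> E \<Longrightarrow>
        inj_on \<psi> V \<Longrightarrow> \<not> noncrossing \<psi> (insert {u, v} E)"
    and outer_edge: "\<And>x y z. {x, y} \<in> E \<Longrightarrow> {y, z} \<in> E \<Longrightarrow> {x, z} \<in> E \<Longrightarrow>
        in_one_triangle E x y \<or> in_one_triangle E y z \<or> in_one_triangle E x z"
begin

lemma edgeV: "{u, v} \<in> E \<Longrightarrow> u \<in> V \<and> v \<in> V \<and> u \<noteq> v"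
  using simple unfolding simple_graph_def by fastforce

lemma finite_V: "finite V" using simple by (simp add: simple_graph_def)

lemma edge_sym: "{u, v} \<in> E \<Longrightarrow> {v, u} \<in> E" by (simp add: insert_commute)

lemma nc: "{u, v} \<in> E \<Longrightarrow> {x, y} \<in> E \<Longrightarrow> \<phi> u < \<phi> x \<Longrightarrow> \<phi> x < \<phi> v \<Longrightarrow> \<phi> v < \<phi> y \<Longrightarrow> False"
  using noncrossing unfolding noncrossing_def by blast

lemma nonadjacent_crossed:
  assumes uv: "u \<in> V" "v \<in> V" "\<phi> u < \<phi> v" "{u, v} \<notin> E"
  obtains x y where "{x, y} \<in> E" "\<phi> u < \<phi> x" "\<phi> x < \<phi> v" "\<phi> y < \<phi> u \<or> \<phi> v < \<phi> y"
proof -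
  have "\<not> noncrossing \<phi> (insert {u, v} E)" using maximal[OF uv(1,2) _ uv(4) inj] uv(3) by auto
  then obtain p q r s where e: "{p, q} \<in> insert {u, v} E" "{r, s} \<in> insert {u, v} E"
    and lt: "\<phi> p < \<phi> r" "\<phi> r < \<phi> q" "\<phi> q < \<phi> s"
    unfolding noncrossing_def by blast
  consider "{p, q} \<in> E" "{r, s} \<in> E" | "{p, q} = {u, v}" "{r, s} \<in> E" | "{p, q} \<in> E" "{r, s} = {u, v}"
    | "{p, q} = {u, v}" "{r, s} = {u, v}" using e by blast
  then show thesis
  proof cases
    case 1 then show ?thesis using nc lt by blast
  next
    case 2
    then have "p = u" "q = v" using lt uv(3) by (auto simp: doubleton_eq_iff)
    then show ?thesis using that[of r s] 2 lt by auto
  next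
    case 3
    then have "r = u" "s = v" using lt uv(3) by (auto simp: doubleton_eq_iff)
    then show ?thesis using that[of q p] 3 lt by (auto simp: insert_commute)
  next
    case 4 then show ?thesis using lt uv(3) by (auto simp: doubleton_eq_iff)
  qed
qed

definition between :: "'a \<Rightarrow> 'a \<Rightarrow> 'a set" where
  "between a b = {v \<in> V. \<phi> a < \<phi> v \<and> \<phi> v < \<phi> b}"

lemma finite_between: "finite (between a b)" using finite_V by (simp add: between_def)

text \<open>
  The triangle below a diagonal: its third vertex is the last neighbour \<open>c\<close> of \<open>a\<close> before \<open>b\<close>, where the
  immediate successor of \<open>a\<close> shows that there is one. An edge separating \<open>c\<close> from \<open>b\<close> would have to
  leave the range from \<open>c\<close> to \<open>b\<close> without crossing \<open>{a, b}\<close> or \<open>{a, c}\<close>, hence end in \<open>a\<close> and make its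
  other end a later neighbour of \<open>a\<close>.
\<close>

lemma apex:
  assumes ab: "{a, b} \<in> E" "\<phi> a < \<phi> b" and ne: "between a b \<noteq> {}"
  obtains c where "c \<in> between a b" "{a, c} \<in> E" "{c, b} \<in> E"
proof -
  have abV: "a \<in> V" "b \<in> V" using edgeV[OF ab(1)] by auto
  obtain s where s: "s \<in> between a b" and smin: "\<And>v. v \<in> between a b \<Longrightarrow> \<phi> s \<le> \<phi> v"
    using obtain_min[OF finite_between ne] by blast
  have "{a, s} \<in> E"
  proof (rule ccontr)
    assume nadj: "{a, s} \<notin> E"
    have "s \<in> V" "\<phi> a < \<phi> s" using s by (simp_all add: between_def)
    then obtain x y where x: "{x, y} \<in> E" "\<phi> a < \<phi> x" "\<phi> x < \<phi> s"
      using nonadjacent_crossed[OF abV(1) _ _ nadj] by blast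
    then have "x \<in> between a b" using s edgeV[OF x(1)] by (auto simp: between_def)
    then show False using smin[of x] x(3) by simp
  qed
  then have Sne: "{c \<in> between a b. {a, c} \<in> E} \<noteq> {}" using s by blast
  have Sfin: "finite {c \<in> between a b. {a, c} \<in> E}" using finite_between by simp
  obtain c where "c \<in> {c \<in> between a b. {a, c} \<in> E}"
    and "\<And>v. v \<in> {c \<in> between a b. {a, c} \<in> E} \<Longrightarrow> \<phi> v \<le> \<phi> c"
    using obtain_max[OF Sfin Sne] by blast
  then have c: "c \<in> between a b" "{a, c} \<in> E"
    and cmax: "\<And>v. v \<in> between a b \<Longrightarrow> {a, v} \<in> E \<Longrightarrow> \<phi> v \<le> \<phi> c" by blast+
  have "{c, b} \<in> E"
  proof (rule ccontr)
    assume "{c, b} \<notin> E"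
    then obtain x y where xy: "{x, y} \<in> E" "\<phi> c < \<phi> x" "\<phi> x < \<phi> b" "\<phi> y < \<phi> c \<or> \<phi> b < \<phi> y"
      using nonadjacent_crossed[of c b] c abV by (auto simp: between_def)
    have xV: "x \<in> V" "y \<in> V" using edgeV[OF xy(1)] by auto
    have ac: "\<phi> a < \<phi> c" using c by (simp add: between_def)
    have "\<not> \<phi> b < \<phi> y" using nc[OF ab(1) xy(1)] xy ac by auto
    moreover have "\<not> \<phi> y < \<phi> a" using nc[OF edge_sym[OF xy(1)] ab(1)] xy ac by auto
    moreover have "\<not> (\<phi> a < \<phi> y \<and> \<phi> y < \<phi> c)" using nc[OF c(2) edge_sym[OF xy(1)]] xy by auto
    moreover have "y \<noteq> a" using cmax[of x] xy xV ac edge_sym[OF xy(1)] by (auto simp: between_def)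
    ultimately have "\<phi> y = \<phi> a" "y \<noteq> a" using xy(4) by auto
    then show False using inj xV abV by (auto simp: inj_on_def)
  qed
  then show thesis using that c by blast
qed

text \<open>
  The strip below a diagonal \<open>{a, b}\<close>, where \<open>d\<close> is the apex of the triangle above it. The
  triangle \<open>a, c, b\<close> below has an outer edge, which is not \<open>{a, b}\<close>, so \<open>{a, c}\<close> or \<open>{c, b}\<close> has nothing
  below it and the strip goes on below the other one. Prepending \<open>c\<close> to the rest keeps the
  neighbourhoods contiguous, because the one of \<open>a\<close> and \<open>b\<close> that is left behind has no neighbours
  further down.
\<close>

lemma strip_order:
  assumes "{a, b} \<in> E" "\<phi> a < \<phi> b" "{a, d} \<in> E" "{b, d} \<in> E" "\<phi> d < \<phi> a \<or> \<phi> b < \<phi> d"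
  shows "\<exists>L. distinct L \<and> set L = between a b \<and> contiguous_list E (a # b # L)"
  using assms
proof (induction "card (between a b)" arbitrary: a b d rule: less_induct)
  case less
  note ab = less.prems(1,2) and d = less.prems(3-5)
  show ?case
  proof (cases "between a b = {}")
    case True then show ?thesis by (intro exI[of _ "[]"]) simp
  next
    case False
    then obtain c where c: "c \<in> between a b" "{a, c} \<in> E" "{c, b} \<in> E" using apex ab by blast
    have lt: "c \<in> V" "\<phi> a < \<phi> c" "\<phi> c < \<phi> b" using c by (auto simp: between_def)
    have abV: "a \<in> V" "b \<in> V" using edgeV[OF ab(1)] by auto
    have "\<not> in_one_triangle E a b"
    proof
      assume "in_one_triangle E a b"
      then have "c = d" using d c(2) edge_sym[OF c(3)] unfolding in_one_triangle_def by blast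
      then show False using d(3) lt by auto
    qed
    then consider "in_one_triangle E a c" | "in_one_triangle E c b"
      using outer_edge[OF c(2,3) ab(1)] by blast
    then obtain L where L: "distinct L" "insert c (set L) = between a b" "c \<notin> set L" "contiguous_list E (c # L)"
      "sorted_wrt (\<lambda>y z. {a, z} \<in> E \<longrightarrow> {a, y} \<in> E) L" "sorted_wrt (\<lambda>y z. {b, z} \<in> E \<longrightarrow> {b, y} \<in> E) L"
    proof cases
      case 1
      have "between a c = {}"
      proof (rule ccontr)
        assume "between a c \<noteq> {}"
        then obtain c' where c': "c' \<in> between a c" "{a, c'} \<in> E" "{c', c} \<in> E"
          using apex[OF c(2) lt(2)] by blast
        then have "c' = b" using 1 ab(1) c edge_sym[OF c'(3)] unfolding in_one_triangle_def by blast
        then show False using c'(1) lt by (auto simp: between_def)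
      qed
      then have split: "between a b = insert c (between c b)"
        using lt inj unfolding between_def inj_on_def by (fastforce simp: not_less)
      then have "card (between c b) < card (between a b)"
        using finite_between[of c b] by (simp add: between_def)
      then obtain L where L: "distinct L" "set L = between c b" "contiguous_list E (c # b # L)"
        using less.hyps[of c b a] c(3) lt edge_sym[OF c(2)] edge_sym[OF ab(1)] by blast
      have "{a, z} \<notin> E" if "z \<in> set L" for z
        using that L(2) nc[of a z c b] c(3) lt by (auto simp: between_def)
      then have "sorted_wrt (\<lambda>y z. {a, z} \<in> E \<longrightarrow> {a, y} \<in> E) L" by (intro sorted_wrt_none)
      then show ?thesis using that[of L] L split by (simp add: between_def)
    next
      case 2
      have "between c b = {}"
      proof (rule ccontr)
        assume "between c b \<noteq> {}"
        then obtain c' where c': "c' \<in> between c b" "{c, c'} \<in> E" "{c', b} \<in> E"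
          using apex[OF c(3) lt(3)] by blast
        then have "c' = a" using 2 edge_sym[OF ab(1)] edge_sym[OF c(2)] edge_sym[OF c'(3)]
          unfolding in_one_triangle_def by blast
        then show False using c'(1) lt by (auto simp: between_def)
      qed
      then have split: "between a b = insert c (between a c)"
        using lt inj unfolding between_def inj_on_def by (fastforce simp: not_less)
      then have "card (between a c) < card (between a b)"
        using finite_between[of a c] by (simp add: between_def)
      then obtain L where L: "distinct L" "set L = between a c" "contiguous_list E (a # c # L)"
        using less.hyps[of a c b] c lt ab(1) by blast
      have "{b, z} \<notin> E" if "z \<in> set L" for z
        using that L(2) nc[of a c z b] c(2) lt edge_sym[of b z] by (auto simp: between_def)
      then have "sorted_wrt (\<lambda>y z. {b, z} \<in> E \<longrightarrow> {b, y} \<in> E) L" by (intro sorted_wrt_none)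
      then show ?thesis using that[of L] L split by (simp add: between_def)
    qed
    have "contiguous_list E (a # b # c # L)"
      using L(4-6) ab(1) c(2) edge_sym[OF c(3)] by simp
    then show ?thesis using L(1-3) by (intro exI[of _ "c # L"]) simp
  qed
qed

text \<open>
  Among the edges with at least one vertex below them take one with the fewest; the two other sides of
  the triangle below it then have none.
\<close>

lemma ear:
  assumes "3 \<le> card V"
  obtains a b c where "{a, b} \<in> E" "\<phi> a < \<phi> b" "between a b = {c}" "{a, c} \<in> E" "{c, b} \<in> E"
proof -
  have Vne: "V \<noteq> {}" using assms by auto
  obtain l where l: "l \<in> V" "\<And>v. v \<in> V \<Longrightarrow> \<phi> l \<le> \<phi> v" using obtain_min[OF finite_V Vne] by blast
  obtain r where r: "r \<in> V" "\<And>v. v \<in> V \<Longrightarrow> \<phi> v \<le> \<phi> r" using obtain_max[OF finite_V Vne] by blast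
  have "card {l, r} < card V" using assms by (simp add: card_insert_if)
  then obtain m where m: "m \<in> V" "m \<noteq> l" "m \<noteq> r"
    by (metis card_mono finite.emptyI finite.insertI insertCI not_less subsetI)
  have m': "\<phi> l < \<phi> m" "\<phi> m < \<phi> r"
    using m l r inj by (auto simp: inj_on_def less_le)
  \<comment> \<open>The first and the last vertex are adjacent, since an edge separating them would leave the layout.\<close>
  have lr: "{l, r} \<in> E"
  proof (rule ccontr)
    assume "{l, r} \<notin> E"
    then obtain x y where "{x, y} \<in> E" "\<phi> y < \<phi> l \<or> \<phi> r < \<phi> y"
      using nonadjacent_crossed[OF l(1) r(1) less_trans[OF m']] by blast
    then show False using l(2)[of y] r(2)[of y] edgeV[of x y] by auto
  qed
  define P where "P = (\<lambda>(a, b). {a, b} \<in> E \<and> \<phi> a < \<phi> b \<and> between a b \<noteq> {})"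
  have "P (l, r)" using lr m' m by (auto simp: P_def between_def)
  then obtain ab where ab: "P ab" "\<And>xy. P xy \<Longrightarrow> card (case_prod between ab) \<le> card (case_prod between xy)"
    using ex_has_least_nat[of P "(l, r)" "\<lambda>x. card (case_prod between x)"] by blast
  obtain a b where "ab = (a, b)" by fastforce
  then have e: "{a, b} \<in> E" "\<phi> a < \<phi> b" "between a b \<noteq> {}"
    and least: "\<And>x y. P (x, y) \<Longrightarrow> card (between a b) \<le> card (between x y)"
    using ab unfolding P_def by fastforce+
  obtain c where c: "c \<in> between a b" "{a, c} \<in> E" "{c, b} \<in> E" using apex[OF e] .
  have lt: "\<phi> a < \<phi> c" "\<phi> c < \<phi> b" "c \<in> V" using c by (auto simp: between_def)
  have "between a c \<subset> between a b" "between c b \<subset> between a b" using c(1) by (auto simp: between_def)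
  then have "card (between a c) < card (between a b)" "card (between c b) < card (between a b)"
    using psubset_card_mono[OF finite_between] by blast+
  then have "\<not> P (a, c)" "\<not> P (c, b)" using least leD by blast+
  then have "between a c = {}" "between c b = {}" using c lt by (auto simp: P_def)
  then have "between a b = {c}"
    using c(1) inj lt(3) unfolding between_def inj_on_def by (fastforce simp: not_less)
  then show thesis using that e c by blast
qed

text \<open>
  Below an arbitrary edge the row of triangles may continue in two directions. To start at one end of
  the row, the layout is rotated so that the tip \<open>c\<close> of an ear comes first: then the edge \<open>{a, b}\<close> has all other vertices below it
  and the triangle \<open>a, b, c\<close> above it.
\<close>

lemma contiguous_enumeration:
  assumes "3 \<le> card V"
  obtains xs where "distinct xs" "set xs = V" "contiguous_list E xs"
proof -
  obtain a b c where ear: "{a, b} \<in> E" "\<phi> a < \<phi> b" "between a b = {c}" "{a, c} \<in> E" "{c, b} \<in> E"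
    using ear[OF assms] .
  have V: "a \<in> V" "b \<in> V" "c \<in> V" using edgeV ear by blast+
  have lt: "\<phi> a < \<phi> c" "\<phi> c < \<phi> b" using ear(3) by (auto simp: between_def)
  obtain K where K: "\<And>u v. u \<in> V \<Longrightarrow> v \<in> V \<Longrightarrow> \<phi> u < \<phi> v + K" using spread_bound[OF finite_V] by blast
  let ?\<psi> = "rotated (\<phi> c) K \<phi>"
  interpret R: striped_polygon V E ?\<psi>
  proof
    show "inj_on ?\<psi> V" using rotated_inj[OF inj K] .
    show "noncrossing ?\<psi> E" using rotated_noncrossing[OF noncrossing _ K] edgeV by blast
  qed (use simple maximal outer_edge in blast)+
  have ba: "?\<psi> b < ?\<psi> a" "?\<psi> c < ?\<psi> b" using lt K[OF V(2,1)] by (auto simp: rotated_def)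
  have btw: "v \<in> R.between b a" if v: "v \<in> V" "v \<notin> {a, b, c}" for v
  proof -
    have "\<phi> v \<noteq> \<phi> a" "\<phi> v \<noteq> \<phi> b" using v V inj by (auto simp: inj_on_def)
    moreover have "v \<notin> between a b" using ear(3) v by auto
    ultimately have "\<phi> v < \<phi> a \<or> \<phi> b < \<phi> v" using v(1) by (auto simp: between_def)
    then show ?thesis using v(1) lt K[OF V(2) v(1)] K[OF v(1) V(1)]
      by (auto simp: R.between_def rotated_def)
  qed
  obtain L where L: "distinct L" "set L = R.between b a" "contiguous_list E (b # a # L)"
    using R.strip_order[of b a c] ear(1,4,5) ba by (auto simp: insert_commute)
  have "{c, z} \<notin> E" if "z \<in> set L" for z
    using R.nc[of c z b a] edge_sym[OF ear(1)] ba that L(2) by (auto simp: R.between_def)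
  then have "sorted_wrt (\<lambda>y z. {c, z} \<in> E \<longrightarrow> {c, y} \<in> E) L" by (intro sorted_wrt_none)
  then have "contiguous_list E (c # b # a # L)" using L(3) ear(5) edge_sym[OF ear(4)] by simp
  moreover have "a \<notin> set L" "b \<notin> set L" "c \<notin> set L"
    unfolding L(2) R.between_def using ba by simp_all
  then have "distinct (c # b # a # L)" using L(1) ear(2) lt by auto
  moreover have "set L \<subseteq> V" unfolding L(2) R.between_def by blast
  then have "set (c # b # a # L) = V" using btw V L(2) by auto
  ultimately show thesis using that by blast
qed

end

section \<open>Chordality of the second power\<close>

theorem proposition4p8:
  fixes V :: "'a set" and E :: "'a set set"
    and pos :: "'a \<Rightarrow> complex" and \<gamma> :: "'a set \<Rightarrow> real \<Rightarrow> complex"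
  assumes "simple_graph V E"
    and "no_isolated_vertices V E"
    and "maximal_outerplane V E pos \<gamma>"
    and "striped V E pos \<gamma>"
  shows "chordal V (second_power V E)"
proof (cases "3 \<le> card V")
  case False
  have "length vs < 4" if "is_cycle V (second_power V E) vs" for vs
    using that False card_mono[of V "set vs"] assms(1) distinct_card[of vs]
    by (auto simp: is_cycle_def simple_graph_def)
  then show ?thesis unfolding chordal_def by fastforce
next
  case True
  have max: "maximal_outerplanar V E" and drawing: "outerplane_drawing V E pos \<gamma>"
    using assms(3) by (simp_all add: maximal_outerplane_def)
  interpret outerplane_graph V E pos \<gamma> using assms(1) drawing by unfold_locales
  obtain \<phi> :: "'a \<Rightarrow> real" where \<phi>: "inj_on \<phi> V" "noncrossing \<phi> E"
    using noncrossing_layout[OF assms(1) no_theta no_crossing_chords] by blast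
  interpret striped_polygon V E \<phi>
  proof
    show "simple_graph V E" "inj_on \<phi> V" "noncrossing \<phi> E" using assms(1) \<phi> .
    show "\<not> noncrossing \<psi> (insert {u, v} E)"
      if "u \<in> V" "v \<in> V" "u \<noteq> v" "{u, v} \<notin> E" "inj_on \<psi> V" for u v and \<psi> :: "'a \<Rightarrow> real"
    proof
      assume "noncrossing \<psi> (insert {u, v} E)"
      then have "outerplanar V (insert {u, v} E)"
        using noncrossing_outerplanar[OF simple_insert[OF assms(1) that(1-3)] that(5)] by blast
      then show False using max that unfolding maximal_outerplanar_def by blast
    qed
    show "in_one_triangle E x y \<or> in_one_triangle E y z \<or> in_one_triangle E x z"
      if tri: "{x, y} \<in> E" "{y, z} \<in> E" "{x, z} \<in> E" for x y z
      using striped_triangle_outer_edge[OF assms(4) tri] .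
  qed
  obtain xs where xs: "distinct xs" "set xs = V" "contiguous_list E xs"
    using contiguous_enumeration[OF True] .
  obtain \<rho> :: "'a \<Rightarrow> real" where "sorted_wrt (\<lambda>u v. \<rho> u < \<rho> v) xs" using ranking[OF xs(1)] by blast
  then have "left_contiguous E V \<rho>" using left_contiguous_of_list[OF xs(3)] xs(2) by simp
  then show ?thesis by (rule chordal_second_power[OF assms(1)])
qed

end
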